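(* Let $m\ge1$ be an integer, $m-1<\mu<m$, $\rho>0$, $\gamma,\omega\in\mathbb C$, and let $R=\mathcal E_{\rho,\mu,\omega}^{\gamma}$. For $v\in C[0,T]$, $$Rv\in \mathrm{AC}_0^m[0,T]\quad\Longleftrightarrow\quad v=\mathcal E_{\rho,m-\mu,\omega}^{-\gamma}w\ \text{ a.e. on }(0,T)\ \text{ for some } w\in L^1(0,T).$$ In that case $Rv=J^mw$ and ${}^C\mathcal D_{\rho,\mu,\omega}^{\gamma}(Rv)=v$ a.e. on $(0,T)$.
   Context: Fix $T>0$; functions are complex-valued. For $\rho,\mu>0$ and $\gamma,z\in\mathbb C$, $E_{\rho,\mu}^{\gamma}(z)=\sum_{n\ge0}\frac{(\gamma)_n}{n!\,\Gamma(\rho n+\mu)}z^n$ with $(\gamma)_n=\gamma(\gamma+1)\cdots(\gamma+n-1)$, $(\gamma)_0=1$, is the three-parameter Mittag--Leffler function. The Prabhakar integral is $(\mathcal E_{\rho,\mu,\omega}^{\gamma}f)(t)=\int_0^t(t-s)^{\mu-1}E_{\rho,\mu}^{\gamma}(\omega(t-s)^\rho)f(s)\,ds$ for $f\in L^1(0,T)$. $(J^mw)(t)=\frac1{(m-1)!}\int_0^t(t-s)^{m-1}w(s)\,ds$. $\mathrm{AC}^m[0,T]=\{u\in C^{m-1}[0,T]:u^{(m-1)}\text{ is absolutely continuous on }[0,T]\}$ and $\mathrm{AC}_0^m[0,T]=\{y\in \mathrm{AC}^m[0,T]:y^{(k)}(0)=0,\ 0\le k<m\}$. The regularized Prabhakar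 derivative is defined on $\mathrm{AC}^m[0,T]$ by ${}^C\mathcal D_{\rho,\mu,\omega}^{\gamma}u=\mathcal E_{\rho,m-\mu,\omega}^{-\gamma}u^{(m)}$. *)

theory Defs
  imports "HOL-Analysis.Analysis"
begin

definition mittag_leffler :: "real \<Rightarrow> real \<Rightarrow> complex \<Rightarrow> complex \<Rightarrow> complex" where
  "mittag_leffler \<rho> \<mu> \<gamma> z =
     (\<Sum>n. pochhammer \<gamma> n / (fact n * Gamma (of_real (\<rho> * real n + \<mu>))) * z ^ n)"

(* Where the integrand is not Lebesgue integrable the value is 0 by the library convention;
   for f in L^1(0,T) and \<mu> > 0 this happens only on a null set of t in (0,T). *)
definition prabhakar_integral ::
  "real \<Rightarrow> real \<Rightarrow> complex \<Rightarrow> complex \<Rightarrow> (real \<Rightarrow> complex) \<Rightarrow> real \<Rightarrow> complex" where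
  "prabhakar_integral \<rho> \<mu> \<gamma> \<omega> f t =
     (LINT s:{0..t}|lebesgue.
        of_real ((t - s) powr (\<mu> - 1)) *
        mittag_leffler \<rho> \<mu> \<gamma> (\<omega> * of_real ((t - s) powr \<rho>)) * f s)"

definition iterated_integral :: "nat \<Rightarrow> (real \<Rightarrow> complex) \<Rightarrow> real \<Rightarrow> complex" where
  "iterated_integral m w t =
     1 / fact (m - 1) * (LINT s:{0..t}|lebesgue. of_real ((t - s) ^ (m - 1)) * w s)"

(* Derivatives are taken within S, so they are one-sided at the endpoints of a closed interval.
   The value is unspecified at points where the derivative does not exist. *)
primrec nth_deriv_on :: "real set \<Rightarrow> nat \<Rightarrow> (real \<Rightarrow> complex) \<Rightarrow> real \<Rightarrow> complex" where
  "nth_deriv_on S 0 u = u"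
| "nth_deriv_on S (Suc k) u = (\<lambda>x. vector_derivative (nth_deriv_on S k u) (at x within S))"

definition C_k_on :: "nat \<Rightarrow> real set \<Rightarrow> (real \<Rightarrow> complex) set" where
  "C_k_on k S = {u. (\<forall>j<k. nth_deriv_on S j u differentiable_on S) \<and>
                    continuous_on S (nth_deriv_on S k u)}"

definition absolutely_continuous_on :: "real set \<Rightarrow> (real \<Rightarrow> complex) \<Rightarrow> bool" where
  "absolutely_continuous_on S f \<longleftrightarrow>
     (\<forall>\<epsilon>>0. \<exists>\<delta>>0. \<forall>P :: (real \<times> real) set.
        finite P \<and> (\<forall>(x, y)\<in>P. x < y \<and> {x..y} \<subseteq> S) \<and>
        disjoint_family_on (\<lambda>(x, y). {x<..<y}) P \<and>
        (\<Sum>(x, y)\<in>P. y - x) < \<delta>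
        \<longrightarrow> (\<Sum>(x, y)\<in>P. norm (f y - f x)) < \<epsilon>)"

definition AC :: "nat \<Rightarrow> real \<Rightarrow> (real \<Rightarrow> complex) set" where
  "AC m T = {u \<in> C_k_on (m - 1) {0..T}.
               absolutely_continuous_on {0..T} (nth_deriv_on {0..T} (m - 1) u)}"

definition AC0 :: "nat \<Rightarrow> real \<Rightarrow> (real \<Rightarrow> complex) set" where
  "AC0 m T = {y \<in> AC m T. \<forall>k<m. nth_deriv_on {0..T} k y 0 = 0}"

definition regularized_prabhakar_deriv ::
  "real \<Rightarrow> nat \<Rightarrow> real \<Rightarrow> real \<Rightarrow> complex \<Rightarrow> complex \<Rightarrow>
     (real \<Rightarrow> complex) \<Rightarrow> real \<Rightarrow> complex" where
  "regularized_prabhakar_deriv T m \<rho> \<mu> \<gamma> \<omega> u =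
     prabhakar_integral \<rho> (real m - \<mu>) (- \<gamma>) \<omega> (nth_deriv_on {0..T} m u)"

end

theory Submission
  imports Defs
begin

text \<open>
  The kernels \<open>k\<^bsub>\<mu>,\<gamma>\<^esub>(u) = u\<^bsup>\<mu>-1\<^esup> E(\<omega> u\<^bsup>\<rho>\<^esup>)\<close> (with \<open>E\<close> the three-parameter
  Mittag-Leffler function of parameters \<open>\<rho>,\<mu>,\<gamma>\<close>) of the Prabhakar integrals form a
  convolution semigroup in the pair \<open>(\<mu>,\<gamma>)\<close>: multiplied out termwise, the convolution of two kernels
  consists of Beta integrals, and the coefficients recombine by the Vandermonde identity for rising
  factorials (\<open>prabhakar_kernel_convolution\<close>). Since \<open>k\<^bsub>m,0\<^esub>(u) = u\<^bsup>m-1\<^esup>/(m-1)!\<close>, the operator \<open>S\<close>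
  with parameters \<open>(m-\<mu>,-\<gamma>)\<close> satisfies \<open>R S = S R = J\<^sup>m\<close> on integrable functions. These identities
  hold at every point and not only almost everywhere: on bounded intervals a kernel of order \<open>\<mu>\<close> is
  bounded by a multiple of \<open>u\<^bsup>\<mu>-1\<^esup>\<close>, so the convolution of the absolute values is bounded by a multiple of \<open>u\<^bsup>m-1\<^esup>\<close>, which is
  bounded because \<open>m \<ge> 1\<close>, and Fubini's theorem applies at each \<open>t\<close> (\<open>volterra_composition\<close>).

  If \<open>v = S w\<close> almost everywhere, then \<open>R v = J\<^sup>m w\<close>, and \<open>J\<^sup>m\<close> maps integrable functions into the functions
  with absolutely continuous derivative of order \<open>m-1\<close> and vanishing initial values. Conversely every
  such function is some \<open>J\<^sup>m w\<close>; then \<open>R v = J\<^sup>m w = R S w\<close>, applying \<open>S\<close> gives \<open>J\<^sup>m v = J\<^sup>m S w\<close>, and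
  \<open>J\<^sup>m\<close> is injective up to null sets, so \<open>v = S w\<close> almost everywhere. The last claim holds because
  the derivative of order \<open>m\<close> of \<open>J\<^sup>m w\<close> is \<open>w\<close> almost everywhere.

  What remains is the real analysis that identifies the range of \<open>J\<^sup>m\<close> and inverts it: Lebesgue's
  differentiation theorem (\<open>Lebesgue_differentiation\<close>, from Henstock's lemma and Vitali's covering
  theorem) and the fact that the absolutely continuous functions are exactly the indefinite integrals up
  to constants (\<open>abs_cont_imp_indefinite_integral\<close>, from the Radon-Nikodym theorem applied to the
  two increasing functions of a Jordan decomposition, and \<open>abs_cont_indefinite_integral\<close>).
\<close>

section \<open>Lebesgue differentiation on the line\<close>

text \<open>Vitali's theorem is used for closed balls; the segment between \<open>x\<close> and \<open>x + h\<close>, for either sign of \<open>h\<close>, is the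
  ball about its midpoint.\<close>

lemma cball_segment_real:
  fixes x h :: real
  shows "cball (x + h/2) (\<bar>h\<bar>/2) = {min x (x+h)..max x (x+h)}"
  by (auto simp: cball_eq_atLeastAtMost min_def max_def field_simps abs_if)

lemma integral_segment_diff:
  fixes f :: "real \<Rightarrow> 'n::euclidean_space"
  assumes f: "f integrable_on {a..b}" and x: "x \<in> {a..b}" "x + h \<in> {a..b}"
  shows "norm (integral {min x (x+h)..max x (x+h)} f - \<bar>h\<bar> *\<^sub>R c) =
         norm (integral {a..x+h} f - integral {a..x} f - h *\<^sub>R c)"
proof (cases "h \<ge> 0")
  case True
  have "integral {a..x} f + integral {x..x+h} f = integral {a..x+h} f"
    using x True by (intro Henstock_Kurzweil_Integration.integral_combine integrable_on_subinterval[OF f]) auto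
  then have "integral {x..x+h} f = integral {a..x+h} f - integral {a..x} f"
    by (simp add: algebra_simps)
  with True show ?thesis by (simp add: min_def max_def)
next
  case False
  have "integral {a..x+h} f + integral {x+h..x} f = integral {a..x} f"
    using x False by (intro Henstock_Kurzweil_Integration.integral_combine integrable_on_subinterval[OF f]) auto
  then have "integral {x+h..x} f = integral {a..x} f - integral {a..x+h} f"
    by (simp add: algebra_simps)
  then have "integral {x+h..x} f - \<bar>h\<bar> *\<^sub>R c = - (integral {a..x+h} f - integral {a..x} f - h *\<^sub>R c)"
    using False by simp
  moreover have "min x (x+h) = x + h" "max x (x+h) = x" using False by auto
  ultimately show ?thesis by (simp only: norm_minus_cancel)
qed

text \<open>Henstock's lemma says that on a fine partial division the Riemann terms \<open>\<bar>h\<bar> f(x)\<close> differ from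
  the increments of the integral by a small total amount. On a segment with a bad difference quotient the two differ by
  at least \<open>c \<bar>h\<bar>\<close>. So the segments with bad quotients, thinned out to a disjoint family by Vitali's theorem, have small
  total length, although they cover the set of bad points up to a null set.\<close>

lemma negligible_bad_quotients:
  fixes f :: "real \<Rightarrow> 'n::euclidean_space"
  assumes f: "f integrable_on {a..b}" and c: "c > 0"
  shows "negligible {x \<in> {a<..<b}. \<forall>d>0. \<exists>h. h \<noteq> 0 \<and> \<bar>h\<bar> < d \<and>
           c * \<bar>h\<bar> < norm (integral {a..x+h} f - integral {a..x} f - h *\<^sub>R f x)}"
    (is "negligible ?E")
  unfolding negligible_outer_le
proof (intro allI impI)
  fix e :: real assume e: "e > 0"
  let ?A = "\<lambda>i. cball (fst i + snd i/2) (\<bar>snd i\<bar>/2)"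
  obtain \<gamma> where \<gamma>: "gauge \<gamma>" and Hen: "\<And>p. \<lbrakk>p tagged_partial_division_of (cbox a b); \<gamma> fine p\<rbrakk> \<Longrightarrow>
             sum (\<lambda>(x,k). norm(measure lborel k *\<^sub>R f x - integral k f)) p < c * e"
    using Henstock_lemma[of f a b "c*e"] f e c by (auto simp: cbox_interval)
  \<comment> \<open>An index \<open>(x,h)\<close> records the tag \<open>x\<close> together with its segment, because Henstock's lemma speaks of
    tagged intervals while Vitali's theorem only sees the balls.\<close>
  define K where "K = {(x,h). x \<in> {a<..<b} \<and> h \<noteq> 0 \<and> ?A (x,h) \<subseteq> \<gamma> x \<and> ?A (x,h) \<subseteq> {a..b} \<and>
          c * \<bar>h\<bar> < norm (integral {a..x+h} f - integral {a..x} f - h *\<^sub>R f x)}"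
  have cov: "\<exists>i. i \<in> K \<and> x \<in> ?A i \<and> \<bar>snd i\<bar>/2 < d" if x: "x \<in> ?E" and d: "d > 0" for x d
  proof -
    have "open (\<gamma> x \<inter> {a<..<b})" "x \<in> \<gamma> x \<inter> {a<..<b}" using \<gamma> x by (auto simp: gauge_def)
    then obtain r where r: "r > 0" "ball x r \<subseteq> \<gamma> x \<inter> {a<..<b}" by (meson openE)
    obtain h where h: "h \<noteq> 0" "\<bar>h\<bar> < min d r"
      "c * \<bar>h\<bar> < norm (integral {a..x+h} f - integral {a..x} f - h *\<^sub>R f x)"
      using x d r by (auto dest!: spec[of _ "min d r"])
    have "?A (x,h) \<subseteq> ball x r"
      unfolding fst_conv snd_conv cball_segment_real using h by (auto simp: ball_eq_greaterThanLessThan)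
    then have "(x,h) \<in> K" using r h x unfolding K_def by auto
    moreover have "x \<in> ?A (x,h)" unfolding fst_conv snd_conv cball_segment_real by auto
    ultimately show ?thesis using h by (intro exI[of _ "(x,h)"]) auto
  qed
  obtain C where C: "countable C" "C \<subseteq> K"
     "pairwise (\<lambda>i j. disjnt (?A i) (?A j)) C"
     "negligible (?E - (\<Union>i \<in> C. ?A i))"
  proof (rule Vitali_covering_theorem_cballs[of K "\<lambda>i. \<bar>snd i\<bar>/2" ?E "\<lambda>i. fst i + snd i/2"])
    show "0 < \<bar>snd i\<bar>/2" if "i \<in> K" for i using that by (auto simp: K_def)
  qed (use cov in blast)+
  have bound: "measure lebesgue (\<Union>i\<in>D. ?A i) \<le> e" if D: "D \<subseteq> C" "finite D" for D
  proof -
    let ?p = "(\<lambda>i. (fst i, ?A i)) ` D"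
    have DK: "D \<subseteq> K" using D C by blast
    have ne: "fst i \<in> ?A i" for i by (simp add: dist_real_def abs_if)
    have disj: "?A i \<inter> ?A j = {}" if "i \<in> D" "j \<in> D" "i \<noteq> j" for i j
      using C(3) D that unfolding pairwise_def disjnt_def by blast
    have inj: "inj_on (\<lambda>i. (fst i, ?A i)) D"
    proof (rule inj_onI, rule ccontr)
      fix i j assume ij: "i \<in> D" "j \<in> D" "(fst i, ?A i) = (fst j, ?A j)" "i \<noteq> j"
      from ij(3) have "?A i = ?A j" by (rule Pair_inject)
      with disj[OF ij(1,2,4)] show False using ne[of i] by blast
    qed
    have "?p tagged_partial_division_of (cbox a b)"
      unfolding tagged_partial_division_of_def
    proof (intro conjI allI impI)
      show "finite ?p" using D by simp
      fix x k assume xk: "(x,k) \<in> ?p"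
      then show "x \<in> k" using ne by auto
      from xk obtain i where i: "i \<in> D" "(x,k) = (fst i, ?A i)" by blast
      have "?A i \<subseteq> {a..b}"
        using subsetD[OF DK i(1)] unfolding K_def by (cases i) simp
      with i show "k \<subseteq> cbox a b" unfolding cbox_interval by simp
      have "k = cbox (min (fst i) (fst i + snd i)) (max (fst i) (fst i + snd i))"
        using i by (simp add: cball_segment_real)
      then show "\<exists>a b. k = cbox a b" by blast
    next
      fix x k y l assume "(x,k) \<in> ?p \<and> (y,l) \<in> ?p \<and> (x,k) \<noteq> (y,l)"
      then have xk: "(x,k) \<in> ?p" and yl: "(y,l) \<in> ?p" and neq: "(x,k) \<noteq> (y,l)" by blast+
      from xk obtain i where i: "i \<in> D" "(x,k) = (fst i, ?A i)" by blast
      from yl obtain j where j: "j \<in> D" "(y,l) = (fst j, ?A j)" by blast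
      have "i \<noteq> j" using i j neq by metis
      from disj[OF i(1) j(1) this] have "k \<inter> l = {}" using i j by simp
      then show "interior k \<inter> interior l = {}" using interior_subset by blast
    qed
    moreover have "\<gamma> fine ?p"
      unfolding fine_def
    proof (clarify del: subsetI)
      fix x k i assume "i \<in> D"
      then show "?A i \<subseteq> \<gamma> (fst i)"
        using subsetD[OF DK] unfolding K_def by (cases i) (simp only: mem_Collect_eq case_prod_conv fst_conv, blast)
    qed
    ultimately have "sum (\<lambda>(x,k). norm(measure lborel k *\<^sub>R f x - integral k f)) ?p < c * e" by (rule Hen)
    also have "sum (\<lambda>(x,k). norm(measure lborel k *\<^sub>R f x - integral k f)) ?p =
        (\<Sum>i\<in>D. norm (measure lborel (?A i) *\<^sub>R f (fst i) - integral (?A i) f))"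
      by (subst sum.reindex[OF inj]) simp
    finally have less: "(\<Sum>i\<in>D. norm (measure lborel (?A i) *\<^sub>R f (fst i) - integral (?A i) f)) < c * e" .
    have "(\<Sum>i\<in>D. c * \<bar>snd i\<bar>) \<le> (\<Sum>i\<in>D. norm (measure lborel (?A i) *\<^sub>R f (fst i) - integral (?A i) f))"
    proof (rule sum_mono)
      fix i assume "i \<in> D"
      then obtain x h where i: "i = (x,h)" "(x,h) \<in> K" using DK by (cases i) auto
      have "x \<in> {a..b}" "x + h \<in> {a..b}" 
        using i(2) unfolding K_def cball_segment_real fst_conv snd_conv by auto
      note seg = integral_segment_diff[OF f this, of "f x"]
      have "norm (measure lborel (?A i) *\<^sub>R f (fst i) - integral (?A i) f) =
         norm (integral {a..x+h} f - integral {a..x} f - h *\<^sub>R f x)"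
      proof -
        have "measure lborel (?A i) = \<bar>h\<bar>" by (simp add: i cball_segment_real min_def max_def)
        then show ?thesis using seg unfolding i fst_conv snd_conv cball_segment_real
          by (metis norm_minus_commute)
      qed
      then show "c * \<bar>snd i\<bar> \<le> norm (measure lborel (?A i) *\<^sub>R f (fst i) - integral (?A i) f)"
        using i by (auto simp: K_def)
    qed
    with less have "c * (\<Sum>i\<in>D. \<bar>snd i\<bar>) < c * e" by (simp add: sum_distrib_left)
    then have sm: "(\<Sum>i\<in>D. \<bar>snd i\<bar>) \<le> e" using c by simp
    have "measure lebesgue (\<Union>i\<in>D. ?A i) \<le> (\<Sum>i\<in>D. measure lebesgue (?A i))"
      using D by (intro measure_UNION_le) auto
    also have "\<dots> = (\<Sum>i\<in>D. \<bar>snd i\<bar>)"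
      by (rule sum.cong) (auto simp: cball_segment_real min_def max_def)
    finally show ?thesis using sm by simp
  qed
  have U: "(\<Union>i\<in>C. ?A i) \<in> lmeasurable"
    by (rule fmeasurable_UN_bound[OF C(1) _ bound]) (auto simp: lmeasurable_cball)
  have mU: "measure lebesgue (\<Union>i\<in>C. ?A i) \<le> e"
    by (rule measure_UN_bound[OF C(1) _ bound]) (auto simp: lmeasurable_cball)
  let ?N = "?E - (\<Union>i\<in>C. ?A i)"
  have N: "?N \<in> lmeasurable" "measure lebesgue ?N = 0"
    using C(4) negligible_iff_measure by blast+
  have "measure lebesgue (?N \<union> (\<Union>i\<in>C. ?A i)) \<le> measure lebesgue ?N + measure lebesgue (\<Union>i\<in>C. ?A i)"
    by (rule measure_Un_le) (use N U in auto)
  then have "measure lebesgue (?N \<union> (\<Union>i\<in>C. ?A i)) \<le> e" using N(2) mU by linarith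
  moreover have "?N \<union> (\<Union>i\<in>C. ?A i) \<in> lmeasurable" using N(1) U by (rule fmeasurable.Un)
  moreover have "?E \<subseteq> ?N \<union> (\<Union>i\<in>C. ?A i)" by blast
  ultimately show "\<exists>T. ?E \<subseteq> T \<and> T \<in> lmeasurable \<and> measure lebesgue T \<le> e" by blast
qed

theorem Lebesgue_differentiation:
  fixes f :: "real \<Rightarrow> 'n::euclidean_space"
  assumes f: "f integrable_on {a..b}"
  shows "negligible {x \<in> {a<..<b}. \<not> ((\<lambda>u. integral {a..u} f) has_vector_derivative f x) (at x)}"
proof (rule negligible_subset)
  let ?E = "\<lambda>c. {x \<in> {a<..<b}. \<forall>d>0. \<exists>h. h \<noteq> 0 \<and> \<bar>h\<bar> < d \<and>
           c * \<bar>h\<bar> < norm (integral {a..x+h} f - integral {a..x} f - h *\<^sub>R f x)}"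
  show "negligible (\<Union>n. ?E (inverse (real (Suc n))))"
    by (intro negligible_Union_nat negligible_bad_quotients[OF f]) simp
  show "{x \<in> {a<..<b}. \<not> ((\<lambda>u. integral {a..u} f) has_vector_derivative f x) (at x)}
      \<subseteq> (\<Union>n. ?E (inverse (real (Suc n))))"
  proof (rule subsetI, rule ccontr)
    fix x assume x: "x \<in> {x \<in> {a<..<b}. \<not> ((\<lambda>u. integral {a..u} f) has_vector_derivative f x) (at x)}"
      and no: "x \<notin> (\<Union>n. ?E (inverse (real (Suc n))))"
    have "((\<lambda>u. integral {a..u} f) has_vector_derivative f x) (at x)"
      unfolding has_vector_derivative_def has_derivative_at_alt
    proof (intro conjI allI impI)
      show "bounded_linear (\<lambda>h. h *\<^sub>R f x)" by (rule bounded_linear_scaleR_left)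
      fix e :: real assume e: "e > 0"
      then obtain n where n: "inverse (real (Suc n)) < e" using reals_Archimedean by blast
      from no have "x \<notin> ?E (inverse (real (Suc n)))" by blast
      with x obtain d where d: "d > 0" "\<And>h. h \<noteq> 0 \<Longrightarrow> \<bar>h\<bar> < d \<Longrightarrow>
          norm (integral {a..x+h} f - integral {a..x} f - h *\<^sub>R f x) \<le> inverse (real (Suc n)) * \<bar>h\<bar>"
        unfolding mem_Collect_eq not_all not_ex not_imp de_Morgan_conj not_not not_less by (metis not_le)
      have "norm (integral {a..y} f - integral {a..x} f - (y - x) *\<^sub>R f x) \<le> e * norm (y - x)" 
        if "norm (y - x) < d" for y
      proof (cases "y = x")
        case False
        from d(2)[of "y - x"] that False
        have "norm (integral {a..y} f - integral {a..x} f - (y - x) *\<^sub>R f x) \<le> inverse (real (Suc n)) * \<bar>y - x\<bar>" by simp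
        also have "\<dots> \<le> e * norm (y - x)" using n e by (intro mult_mono) auto
        finally show ?thesis .
      qed auto
      then show "\<exists>d>0. \<forall>y. norm (y - x) < d \<longrightarrow>
        norm (integral {a..y} f - integral {a..x} f - (y - x) *\<^sub>R f x) \<le> e * norm (y - x)" using d by blast
    qed
    with x show False by simp
  qed
qed

section \<open>Absolutely continuous functions are indefinite integrals\<close>

text \<open>This supplies the length bound
  under which absolute continuity can be applied to a family of intervals.\<close>

lemma sum_lengths_le_measure:
  fixes x y :: "'i \<Rightarrow> real"
  assumes "finite I" "\<And>i. i \<in> I \<Longrightarrow> x i \<le> y i" "disjoint_family_on (\<lambda>i. {x i<..<y i}) I"
    and U: "U \<in> lmeasurable" "\<And>i. i \<in> I \<Longrightarrow> {x i<..<y i} \<subseteq> U"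
  shows "(\<Sum>i\<in>I. y i - x i) \<le> measure lebesgue U"
proof -
  have "(\<Sum>i\<in>I. y i - x i) = (\<Sum>i\<in>I. measure lebesgue {x i<..<y i})"
    using assms(2) by (intro sum.cong) auto
  also have "\<dots> = measure lebesgue (\<Union>i\<in>I. {x i<..<y i})"
    using assms(1-3) by (subst measure_finite_Union) (auto simp: emeasure_lborel_Ioo)
  also have "\<dots> \<le> measure lebesgue U"
    using U assms(1) by (intro measure_mono_fmeasurable) auto
  finally show ?thesis .
qed

text \<open>The inner clause of the \<open>\<epsilon>\<close>-\<open>\<delta>\<close> definition of absolute continuity, for values in any normed space:
  real-valued functions are needed for the variation argument, complex ones for the result.\<close>

definition small_oscillation :: "(real \<Rightarrow> 'a::real_normed_vector) \<Rightarrow> real \<Rightarrow> real \<Rightarrow> real \<Rightarrow> real \<Rightarrow> bool" where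
  "small_oscillation f a b \<delta> \<epsilon> \<longleftrightarrow> (\<forall>P :: (real \<times> real) set.
        finite P \<and> (\<forall>(x, y)\<in>P. x < y \<and> {x..y} \<subseteq> {a..b}) \<and>
        disjoint_family_on (\<lambda>(x, y). {x<..<y}) P \<and>
        (\<Sum>(x, y)\<in>P. y - x) < \<delta>
        \<longrightarrow> (\<Sum>(x, y)\<in>P. norm (f y - f x)) < \<epsilon>)"

text \<open>Families indexed by an arbitrary finite set, in which degenerate intervals are allowed, are more convenient
  than sets of intervals: cutting all members at a point keeps the index set.\<close>

lemma small_oscillation_family:
  fixes x y :: "'i \<Rightarrow> real"
  assumes f: "small_oscillation f a b \<delta> \<epsilon>" and I: "finite I"
    and xy: "\<And>i. i \<in> I \<Longrightarrow> a \<le> x i \<and> x i \<le> y i \<and> y i \<le> b"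
    and disj: "disjoint_family_on (\<lambda>i. {x i<..<y i}) I"
    and len: "(\<Sum>i\<in>I. y i - x i) < \<delta>"
  shows "(\<Sum>i\<in>I. norm (f (y i) - f (x i))) < \<epsilon>"
proof -
  define J where "J = {i \<in> I. x i < y i}"
  let ?h = "\<lambda>i. (x i, y i)"
  have dj: "{x i<..<y i} \<inter> {x j<..<y j} = {}" if "i \<in> J" "j \<in> J" "i \<noteq> j" for i j
    using disj that unfolding disjoint_family_on_def J_def by blast
  have inj: "inj_on ?h J"
  proof (rule inj_onI, rule ccontr)
    fix i j assume "i \<in> J" "j \<in> J" "?h i = ?h j" "i \<noteq> j"
    with dj[of i j] have "{x i<..<y i} = {}" by auto
    with \<open>i \<in> J\<close> show False by (auto simp: J_def)
  qed
  have "(\<Sum>(u,v)\<in>?h ` J. v - u) = (\<Sum>i\<in>J. y i - x i)"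
    by (subst sum.reindex[OF inj]) simp
  also have "\<dots> = (\<Sum>i\<in>I. y i - x i)"
    using xy I unfolding J_def by (intro sum.mono_neutral_left) force+
  finally have len': "(\<Sum>(u,v)\<in>?h ` J. v - u) < \<delta>" using len by simp
  have "disjoint_family_on (\<lambda>(u, v). {u<..<v}) (?h ` J)"
    unfolding disjoint_family_on_def
  proof (intro ballI impI)
    fix p q assume "p \<in> ?h ` J" "q \<in> ?h ` J" "p \<noteq> q"
    then obtain i j where "i \<in> J" "j \<in> J" "p = ?h i" "q = ?h j" "i \<noteq> j" by blast
    with dj[of i j] show "(case p of (u,v) \<Rightarrow> {u<..<v}) \<inter> (case q of (u,v) \<Rightarrow> {u<..<v}) = {}" by simp
  qed
  moreover have "finite (?h ` J)" using I by (simp add: J_def)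
  moreover have "\<forall>(u,v)\<in>?h ` J. u < v \<and> {u..v} \<subseteq> {a..b}"
    using xy by (force simp: J_def)
  ultimately have "(\<Sum>(u, v)\<in>?h ` J. norm (f v - f u)) < \<epsilon>"
    using f len' unfolding small_oscillation_def by blast
  also have "(\<Sum>(u, v)\<in>?h ` J. norm (f v - f u)) = (\<Sum>i\<in>J. norm (f (y i) - f (x i)))"
    by (subst sum.reindex[OF inj]) simp
  also have "\<dots> = (\<Sum>i\<in>I. norm (f (y i) - f (x i)))"
  proof (rule sum.mono_neutral_left)
    show "\<forall>i\<in>I - J. norm (f (y i) - f (x i)) = 0"
    proof
      fix i assume "i \<in> I - J"
      then have "y i = x i" using xy[of i] by (auto simp: J_def)
      then show "norm (f (y i) - f (x i)) = 0" by simp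
    qed
  qed (use I in \<open>auto simp: J_def\<close>)
  finally show ?thesis .
qed

lemma small_oscillation_mono:
  assumes "small_oscillation f a b \<delta> \<epsilon>" "\<And>x y. norm (g y - g x) \<le> norm (f y - f x)"
  shows "small_oscillation g a b \<delta> \<epsilon>"
  unfolding small_oscillation_def
proof (intro allI impI)
  fix P :: "(real \<times> real) set"
  assume P: "finite P \<and> (\<forall>(x, y)\<in>P. x < y \<and> {x..y} \<subseteq> {a..b}) \<and>
        disjoint_family_on (\<lambda>(x, y). {x<..<y}) P \<and> (\<Sum>(x, y)\<in>P. y - x) < \<delta>"
  have "(\<Sum>(x, y)\<in>P. norm (g y - g x)) \<le> (\<Sum>(x, y)\<in>P. norm (f y - f x))"
    using assms(2) by (intro sum_mono) auto
  also have "\<dots> < \<epsilon>" using assms(1) P unfolding small_oscillation_def by blast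
  finally show "(\<Sum>(x, y)\<in>P. norm (g y - g x)) < \<epsilon>" .
qed

definition abs_cont :: "real \<Rightarrow> real \<Rightarrow> (real \<Rightarrow> 'a::real_normed_vector) \<Rightarrow> bool" where
  "abs_cont a b f \<longleftrightarrow> (\<forall>\<epsilon>>0. \<exists>\<delta>>0. small_oscillation f a b \<delta> \<epsilon>)"

lemma abs_cont_iff: "abs_cont a b f \<longleftrightarrow> absolutely_continuous_on {a..b} f"
  unfolding abs_cont_def small_oscillation_def absolutely_continuous_on_def ..

lemma abs_contD:
  assumes "abs_cont a b f" "\<epsilon> > 0"
  obtains \<delta> where "\<delta> > 0" "small_oscillation f a b \<delta> \<epsilon>"
  using assms unfolding abs_cont_def by blast

lemma abs_cont_mono:
  assumes "abs_cont a b f" "\<And>x y. norm (g y - g x) \<le> norm (f y - f x)"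
  shows "abs_cont a b g"
  unfolding abs_cont_def
proof (intro allI impI)
  fix e :: real assume "e > 0"
  from abs_contD[OF assms(1) this] obtain d where "d > 0" "small_oscillation f a b d e" by blast
  then show "\<exists>d>0. small_oscillation g a b d e"
    by (intro exI[of _ d] conjI small_oscillation_mono[OF _ assms(2)])
qed

lemma abs_cont_cong:
  assumes "\<And>x. x \<in> {a..b} \<Longrightarrow> f x = g x" "abs_cont a b f"
  shows "abs_cont a b g"
  unfolding abs_cont_def
proof (intro allI impI)
  fix e :: real assume "e > 0"
  from abs_contD[OF assms(2) this] obtain d where d: "d > 0" "small_oscillation f a b d e" by blast
  have "small_oscillation g a b d e"
    unfolding small_oscillation_def
  proof (intro allI impI, elim conjE)
    fix P :: "(real \<times> real) set"
    assume P: "finite P" "\<forall>(x, y)\<in>P. x < y \<and> {x..y} \<subseteq> {a..b}"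
      "disjoint_family_on (\<lambda>(x, y). {x<..<y}) P" "(\<Sum>(x, y)\<in>P. y - x) < d"
    have "(\<Sum>(x, y)\<in>P. norm (g y - g x)) = (\<Sum>(x, y)\<in>P. norm (f y - f x))"
    proof (rule sum.cong[OF refl], clarify)
      fix x y assume "(x,y) \<in> P"
      then have "x \<in> {a..b}" "y \<in> {a..b}" using P(2) by auto
      then show "norm (g y - g x) = norm (f y - f x)" by (simp add: assms(1))
    qed
    also have "\<dots> < e" using d(2) P unfolding small_oscillation_def by blast
    finally show "(\<Sum>(x, y)\<in>P. norm (g y - g x)) < e" .
  qed
  with d show "\<exists>d>0. small_oscillation g a b d e" by blast
qed

lemma abs_cont_diff:
  assumes "abs_cont a b f" "abs_cont a b g"
  shows "abs_cont a b (\<lambda>x. f x - g x)"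
  unfolding abs_cont_def
proof (intro allI impI)
  fix e :: real assume "e > 0"
  then have e: "e/2 > 0" by simp
  from abs_contD[OF assms(1) e] obtain d1 where d1: "d1 > 0" "small_oscillation f a b d1 (e/2)" by blast
  from abs_contD[OF assms(2) e] obtain d2 where d2: "d2 > 0" "small_oscillation g a b d2 (e/2)" by blast
  have "small_oscillation (\<lambda>x. f x - g x) a b (min d1 d2) e"
    unfolding small_oscillation_def
  proof (intro allI impI)
    fix P :: "(real \<times> real) set"
    assume P: "finite P \<and> (\<forall>(x, y)\<in>P. x < y \<and> {x..y} \<subseteq> {a..b}) \<and>
          disjoint_family_on (\<lambda>(x, y). {x<..<y}) P \<and> (\<Sum>(x, y)\<in>P. y - x) < min d1 d2"
    have "(\<Sum>(x, y)\<in>P. norm (f y - g y - (f x - g x))) \<le> (\<Sum>(x, y)\<in>P. norm (f y - f x) + norm (g y - g x))"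
    proof (rule sum_mono, clarify)
      fix x y
      have "f y - g y - (f x - g x) = (f y - f x) - (g y - g x)" by simp
      then show "norm (f y - g y - (f x - g x)) \<le> norm (f y - f x) + norm (g y - g x)"
        by (simp only: norm_triangle_ineq4)
    qed
    also have "\<dots> = (\<Sum>(x, y)\<in>P. norm (f y - f x)) + (\<Sum>(x, y)\<in>P. norm (g y - g x))"
      by (simp add: split_def sum.distrib)
    also have "(\<Sum>(x, y)\<in>P. norm (f y - f x)) < e/2"
      using d1 P unfolding small_oscillation_def by (meson less_le_trans min.cobounded1)
    also have "(\<Sum>(x, y)\<in>P. norm (g y - g x)) < e/2"
      using d2 P unfolding small_oscillation_def by (meson less_le_trans min.cobounded2)
    finally show "(\<Sum>(x, y)\<in>P. norm (f y - g y - (f x - g x))) < e" by simp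
  qed
  then show "\<exists>d>0. small_oscillation (\<lambda>x. f x - g x) a b d e" using d1 d2 by (intro exI[of _ "min d1 d2"]) auto
qed

lemma abs_cont_continuous:
  assumes "abs_cont a b f"
  shows "continuous_on {a..b} f"
  unfolding continuous_on_iff
proof (intro ballI allI impI)
  fix x e :: real assume x: "x \<in> {a..b}" and e: "e > 0"
  from abs_contD[OF assms e] obtain d where d: "d > 0" "small_oscillation f a b d e" by blast
  have "dist (f y) (f x) < e" if y: "y \<in> {a..b}" "dist y x < d" for y
  proof -
    have "(\<Sum>i\<in>{0::nat}. norm (f (max x y) - f (min x y))) < e"
      by (rule small_oscillation_family[OF d(2)]) (use x y in \<open>auto simp: dist_real_def max_def min_def disjoint_family_on_def\<close>)
    then show ?thesis by (auto simp: dist_norm max_def min_def norm_minus_commute split: if_splits)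
  qed
  then show "\<exists>d>0. \<forall>y\<in>{a..b}. dist y x < d \<longrightarrow> dist (f y) (f x) < e" using d by blast
qed

text \<open>The sums approximating the positive variation from below. Increments are counted with their sign, so a
  family that skips the decreasing parts of \<open>g\<close> does best.\<close>

definition increment_sums :: "(real \<Rightarrow> real) \<Rightarrow> real \<Rightarrow> real \<Rightarrow> real set" where
  "increment_sums g a b = {(\<Sum>i<n. g (y i) - g (x i)) | n x y.
     (\<forall>i<n. a \<le> x i \<and> x i \<le> y i \<and> y i \<le> b) \<and> disjoint_family_on (\<lambda>i. {x i<..<y i}) {..<n::nat}}"

definition positive_variation :: "(real \<Rightarrow> real) \<Rightarrow> real \<Rightarrow> real \<Rightarrow> real" where
  "positive_variation g a b = Sup (increment_sums g a b)"

lemma zero_in_increment_sums: "0 \<in> increment_sums g a b"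
  unfolding increment_sums_def by (intro CollectI exI[of _ 0]) (auto simp: disjoint_family_on_def)

lemma increment_sums_mono: "b \<le> c \<Longrightarrow> increment_sums g a b \<subseteq> increment_sums g a c"
  unfolding increment_sums_def by (blast intro: order_trans)

text \<open>The interval \<open>[b,c]\<close> itself may be added to a family in \<open>[a,b]\<close>. In terms of the positive variation \<open>V\<close>
  this says that \<open>V - g\<close> is increasing.\<close>

lemma increment_sums_append:
  assumes "s \<in> increment_sums g a b" "a \<le> b" "b \<le> c"
  shows "s + (g c - g b) \<in> increment_sums g a c"
proof -
  from assms(1) obtain n x y where s: "s = (\<Sum>i<n. g (y i) - g (x i))"
    and xy: "\<forall>i<n. a \<le> x i \<and> x i \<le> y i \<and> y i \<le> b" and dj: "disjoint_family_on (\<lambda>i. {x i<..<y i}) {..<n::nat}"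
    unfolding increment_sums_def by blast
  have "s + (g c - g b) = (\<Sum>i<Suc n. g ((y(n := c)) i) - g ((x(n := b)) i))"
    unfolding s by simp
  moreover have "\<forall>i<Suc n. a \<le> (x(n:=b)) i \<and> (x(n:=b)) i \<le> (y(n:=c)) i \<and> (y(n:=c)) i \<le> c"
    using xy assms by (auto simp: less_Suc_eq)
  moreover have "disjoint_family_on (\<lambda>i. {(x(n:=b)) i<..<(y(n:=c)) i}) {..<Suc n}"
    unfolding disjoint_family_on_def
  proof (intro ballI impI)
    fix i j assume ij: "i \<in> {..<Suc n}" "j \<in> {..<Suc n}" "i \<noteq> j"
    have *: "{x k<..<y k} \<inter> {b<..<c} = {}" if "k < n" for k
      using xy that by fastforce
    have "{x i<..<y i} \<inter> {x j<..<y j} = {}" if "i < n" "j < n"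
      using dj that ij unfolding disjoint_family_on_def by blast
    then show "{(x(n:=b)) i<..<(y(n:=c)) i} \<inter> {(x(n:=b)) j<..<(y(n:=c)) j} = {}"
      using ij *[of i] *[of j] by (cases "i < n"; cases "j < n") (auto simp: less_Suc_eq)
  qed
  ultimately show ?thesis unfolding increment_sums_def by blast
qed

text \<open>Cutting every interval of a family at \<open>b\<close> does not change the sum, since the increments add up.\<close>

lemma increment_sums_split:
  assumes "s \<in> increment_sums g a c" "a \<le> b" "b \<le> c"
  obtains s1 s2 where "s1 \<in> increment_sums g a b" "s2 \<in> increment_sums g b c" "s = s1 + s2"
proof -
  from assms(1) obtain n x y where s: "s = (\<Sum>i<n. g (y i) - g (x i))"
    and xy: "\<forall>i<n. a \<le> x i \<and> x i \<le> y i \<and> y i \<le> c" and dj: "disjoint_family_on (\<lambda>i. {x i<..<y i}) {..<n::nat}"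
    unfolding increment_sums_def by blast
  let ?s1 = "\<Sum>i<n. g (min b (y i)) - g (min b (x i))" and ?s2 = "\<Sum>i<n. g (max b (y i)) - g (max b (x i))"
  have sub1: "{min b (x i)<..<min b (y i)} \<subseteq> {x i<..<y i}" for i by auto
  have sub2: "{max b (x i)<..<max b (y i)} \<subseteq> {x i<..<y i}" for i by auto
  have "disjoint_family_on (\<lambda>i. {min b (x i)<..<min b (y i)}) {..<n}"
    using dj sub1 unfolding disjoint_family_on_def by blast
  moreover have "\<forall>i<n. a \<le> min b (x i) \<and> min b (x i) \<le> min b (y i) \<and> min b (y i) \<le> b"
    using xy assms by (auto simp: min_def)
  ultimately have 1: "?s1 \<in> increment_sums g a b"
    unfolding increment_sums_def
    by (intro CollectI exI[of _ n] exI[of _ "\<lambda>i. min b (x i)"] exI[of _ "\<lambda>i. min b (y i)"]) simp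
  have "disjoint_family_on (\<lambda>i. {max b (x i)<..<max b (y i)}) {..<n}"
    using dj sub2 unfolding disjoint_family_on_def by blast
  moreover have "\<forall>i<n. b \<le> max b (x i) \<and> max b (x i) \<le> max b (y i) \<and> max b (y i) \<le> c"
    using xy assms by (auto simp: max_def)
  ultimately have 2: "?s2 \<in> increment_sums g b c"
    unfolding increment_sums_def
    by (intro CollectI exI[of _ n] exI[of _ "\<lambda>i. max b (x i)"] exI[of _ "\<lambda>i. max b (y i)"]) simp
  have "s = ?s1 + ?s2"
    unfolding s sum.distrib[symmetric] using xy by (intro sum.cong) (auto simp: min_def max_def)
  with 1 2 that show ?thesis by blast
qed

lemma increment_sums_small:
  assumes "small_oscillation g c d \<delta> \<epsilon>" "d - c < \<delta>" "c \<le> d" "s \<in> increment_sums g c d"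
  shows "s < \<epsilon>"
proof -
  from assms(4) obtain n x y where s: "s = (\<Sum>i<n. g (y i) - g (x i))"
    and xy: "\<forall>i<n. c \<le> x i \<and> x i \<le> y i \<and> y i \<le> d" and dj: "disjoint_family_on (\<lambda>i. {x i<..<y i}) {..<n::nat}"
    unfolding increment_sums_def by blast
  have "(\<Sum>i<n. y i - x i) \<le> measure lebesgue {c..d}"
  proof (rule sum_lengths_le_measure[OF _ _ dj])
    show "x i \<le> y i" "{x i<..<y i} \<subseteq> {c..d}" if "i \<in> {..<n}" for i
      using xy that by (fastforce, force)
  qed auto
  also have "\<dots> < \<delta>" using assms by simp
  finally have "(\<Sum>i<n. norm (g (y i) - g (x i))) < \<epsilon>"
    using xy dj by (intro small_oscillation_family[OF assms(1)]) auto
  moreover have "s \<le> (\<Sum>i<n. norm (g (y i) - g (x i)))"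
    unfolding s by (intro sum_mono) auto
  ultimately show ?thesis by simp
qed

lemma small_oscillation_subinterval:
  "small_oscillation f a b \<delta> \<epsilon> \<Longrightarrow> a \<le> c \<Longrightarrow> d \<le> b \<Longrightarrow> small_oscillation f c d \<delta> \<epsilon>"
  unfolding small_oscillation_def
proof (intro allI impI, elim conjE)
  fix P :: "(real \<times> real) set"
  assume f: "\<forall>P. finite P \<and> (\<forall>(x, y)\<in>P. x < y \<and> {x..y} \<subseteq> {a..b}) \<and>
      disjoint_family_on (\<lambda>(x, y). {x<..<y}) P \<and> (\<Sum>(x, y)\<in>P. y - x) < \<delta> \<longrightarrow>
      (\<Sum>(x, y)\<in>P. norm (f y - f x)) < \<epsilon>"
    and cd: "a \<le> c" "d \<le> b" and P: "\<forall>(x, y)\<in>P. x < y \<and> {x..y} \<subseteq> {c..d}"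
    and rest: "finite P" "disjoint_family_on (\<lambda>(x, y). {x<..<y}) P" "(\<Sum>(x, y)\<in>P. y - x) < \<delta>"
  have "{c..d} \<subseteq> {a..b}" using cd by auto
  with P have "\<forall>(x, y)\<in>P. x < y \<and> {x..y} \<subseteq> {a..b}" by blast
  with f rest show "(\<Sum>(x, y)\<in>P. norm (f y - f x)) < \<epsilon>" by blast
qed

text \<open>With \<open>\<delta>\<close> belonging to \<open>\<epsilon> = 1\<close>, cutting at steps of length \<open>\<delta>/2\<close> splits a family into finitely many
  parts, each contributing at most 1.\<close>

lemma increment_sums_bdd_above:
  assumes "abs_cont a b g" "c \<in> {a..b}"
  shows "bdd_above (increment_sums g a c)"
proof -
  from abs_contD[OF assms(1), of 1] obtain d where d: "d > 0" "small_oscillation g a b d 1" by auto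
  have *: "s \<le> real k" if "c \<in> {a..b}" "c - a \<le> real k * (d/2)" "s \<in> increment_sums g a c" for k s c
    using that
  proof (induction k arbitrary: s c)
    case 0
    then have "c = a" by auto
    with 0 have "s \<in> increment_sums g a a" by simp
    then obtain n x y where s: "s = (\<Sum>i<n::nat. g (y i) - g (x i))"
      and xy: "\<forall>i<n. a \<le> x i \<and> x i \<le> y i \<and> y i \<le> a"
      unfolding increment_sums_def by blast
    have "y i = x i" if "i < n" for i using xy that by (meson order_antisym order_trans)
    then show ?case by (simp add: s)
  next
    case (Suc k)
    let ?b = "max a (c - d/2)"
    obtain s1 s2 where s: "s1 \<in> increment_sums g a ?b" "s2 \<in> increment_sums g ?b c" "s = s1 + s2"
      using increment_sums_split[OF Suc.prems(3), of ?b] Suc.prems d by auto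
    have "s1 \<le> real k"
    proof (rule Suc.IH[OF _ _ s(1)])
      show "?b \<in> {a..b}" using Suc.prems(1) d by auto
      show "?b - a \<le> real k * (d/2)" using Suc.prems(2) d by (auto simp: max_def algebra_simps)
    qed
    moreover have "s2 < 1"
      by (rule increment_sums_small[OF small_oscillation_subinterval[OF d(2)] _ _ s(2)])
         (use Suc.prems d in auto)
    ultimately show ?case using s by simp
  qed
  obtain k where "(c - a) / (d/2) < real k" using reals_Archimedean2 by blast
  then have "c - a \<le> real k * (d/2)" using d by (simp add: field_simps)
  then show ?thesis using *[OF assms(2)] by (intro bdd_aboveI) blast
qed

lemma positive_variation_increment:
  assumes "abs_cont a b g" "a \<le> c" "c \<le> d" "d \<le> b"
  shows "positive_variation g a c \<le> positive_variation g a d"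
    and "positive_variation g a c + (g d - g c) \<le> positive_variation g a d"
    and "\<eta> > 0 \<Longrightarrow> \<exists>s\<in>increment_sums g c d. positive_variation g a d - positive_variation g a c \<le> s + \<eta>"
proof -
  have bd: "bdd_above (increment_sums g a c)" "bdd_above (increment_sums g a d)"
    using assms by (auto intro: increment_sums_bdd_above)
  have ne: "increment_sums g a e \<noteq> {}" for e using zero_in_increment_sums by blast
  show "positive_variation g a c \<le> positive_variation g a d"
    unfolding positive_variation_def using increment_sums_mono[OF assms(3)] bd ne by (intro cSup_subset_mono) auto
  have "positive_variation g a c \<le> positive_variation g a d - (g d - g c)"
    unfolding positive_variation_def
  proof (rule cSup_least[OF ne])
    fix s assume "s \<in> increment_sums g a c"
    from increment_sums_append[OF this assms(2,3)] bd(2)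
    have "s + (g d - g c) \<le> Sup (increment_sums g a d)" by (rule cSup_upper)
    then show "s \<le> Sup (increment_sums g a d) - (g d - g c)" by simp
  qed
  then show "positive_variation g a c + (g d - g c) \<le> positive_variation g a d" by simp
  assume \<eta>: "\<eta> > 0"
  have "positive_variation g a d - \<eta> < Sup (increment_sums g a d)" using \<eta> by (simp add: positive_variation_def)
  then obtain s where s: "s \<in> increment_sums g a d" "positive_variation g a d - \<eta> < s"
    using less_cSupD[OF ne] by blast
  obtain s1 s2 where s12: "s1 \<in> increment_sums g a c" "s2 \<in> increment_sums g c d" "s = s1 + s2"
    using increment_sums_split[OF s(1) assms(2,3)] by blast
  have "s1 \<le> positive_variation g a c" unfolding positive_variation_def using s12(1) bd(1) by (rule cSup_upper)
  with s s12 show "\<exists>s\<in>increment_sums g c d. positive_variation g a d - positive_variation g a c \<le> s + \<eta>"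
    by (intro bexI[of _ s2]) auto
qed

text \<open>The variation over an interval is nearly attained by a family inside it. Near-optimal families in
  disjoint intervals together form one disjoint family whose total length is no larger, so the \<open>\<delta>\<close> of \<open>g\<close> for
  \<open>\<epsilon>/2\<close> serves for the variation.\<close>

lemma abs_cont_positive_variation:
  assumes g: "abs_cont a b g"
  shows "abs_cont a b (positive_variation g a)"
  unfolding abs_cont_def
proof (intro allI impI)
  fix e :: real assume e: "e > 0"
  from abs_contD[OF g, of "e/2"] e obtain \<delta> where \<delta>: "\<delta> > 0" "small_oscillation g a b \<delta> (e/2)" by auto
  let ?V = "positive_variation g a"
  have "small_oscillation ?V a b \<delta> e"
    unfolding small_oscillation_def
  proof (intro allI impI, elim conjE)
    fix P :: "(real \<times> real) set"
    assume fin: "finite P" and P: "\<forall>(x, y)\<in>P. x < y \<and> {x..y} \<subseteq> {a..b}"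
      and dj: "disjoint_family_on (\<lambda>(x, y). {x<..<y}) P" and len: "(\<Sum>(x, y)\<in>P. y - x) < \<delta>"
    have Pd: "a \<le> fst p" "fst p < snd p" "snd p \<le> b" if "p \<in> P" for p
      using P that by (auto simp: split_def dest!: bspec)
    \<comment> \<open>All intervals of \<open>P\<close> together may lose at most \<open>e/2\<close>; adding 1 avoids a division by 0 if \<open>P\<close> is empty.\<close>
    define \<eta> where "\<eta> = e / 2 / (real (card P) + 1)"
    have \<eta>: "\<eta> > 0" using e by (simp add: \<eta>_def)
    let ?Q = "\<lambda>p (n, x, y). (\<forall>i<n::nat. fst p \<le> x i \<and> x i \<le> y i \<and> y i \<le> snd p) \<and>
        disjoint_family_on (\<lambda>i. {x i<..<y i}) {..<n} \<and>
        ?V (snd p) - ?V (fst p) \<le> (\<Sum>i<n. g (y i) - g (x i)) + \<eta>"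
    have "\<forall>p\<in>P. \<exists>q. ?Q p q"
    proof
      fix p assume p: "p \<in> P"
      from positive_variation_increment(3)[OF g _ _ _ \<eta>, of "fst p" "snd p"] Pd[OF p]
      obtain s where "s \<in> increment_sums g (fst p) (snd p)" "?V (snd p) - ?V (fst p) \<le> s + \<eta>" by auto
      then show "\<exists>q. ?Q p q" unfolding increment_sums_def by blast
    qed
    from bchoice[OF this] obtain q where q: "\<forall>p\<in>P. ?Q p (q p)" by blast
    define n x y where "n p = fst (q p)" and "x p = fst (snd (q p))" and "y p = snd (snd (q p))" for p
    have xy: "\<And>p i. p \<in> P \<Longrightarrow> i < n p \<Longrightarrow> fst p \<le> x p i \<and> x p i \<le> y p i \<and> y p i \<le> snd p"
      and djp: "\<And>p. p \<in> P \<Longrightarrow> disjoint_family_on (\<lambda>i. {x p i<..<y p i}) {..<n p}"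
      and V: "\<And>p. p \<in> P \<Longrightarrow> ?V (snd p) - ?V (fst p) \<le> (\<Sum>i<n p. g (y p i) - g (x p i)) + \<eta>"
      using q unfolding n_def x_def y_def by (auto simp: split_def)
    let ?I = "SIGMA p:P. {..<n p}"
    have "(\<Sum>(p,i)\<in>?I. norm (g (y p i) - g (x p i))) < e/2"
      unfolding split_def
    proof (rule small_oscillation_family[OF \<delta>(2)])
      show "finite ?I" using fin by auto
      show "a \<le> x (fst q) (snd q) \<and> x (fst q) (snd q) \<le> y (fst q) (snd q) \<and> y (fst q) (snd q) \<le> b"
        if "q \<in> ?I" for q
        using that xy[of "fst q" "snd q"] Pd[of "fst q"] by auto
      show "disjoint_family_on (\<lambda>q. {x (fst q) (snd q)<..<y (fst q) (snd q)}) ?I"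
        unfolding disjoint_family_on_def
      proof (intro ballI impI)
        fix q r assume q: "q \<in> ?I" and r: "r \<in> ?I" and qr: "q \<noteq> r"
        show "{x (fst q) (snd q)<..<y (fst q) (snd q)} \<inter> {x (fst r) (snd r)<..<y (fst r) (snd r)} = {}"
        proof (cases "fst q = fst r")
          case True
          then have "snd q \<noteq> snd r" using qr by (metis prod.expand)
          with True djp[of "fst q"] q r show ?thesis unfolding disjoint_family_on_def by auto
        next
          case False
          have "{fst (fst q)<..<snd (fst q)} \<inter> {fst (fst r)<..<snd (fst r)} = {}"
          proof -
            have "fst q \<in> P" "fst r \<in> P" using q r by auto
            with dj False show ?thesis unfolding disjoint_family_on_def split_def by blast
          qed
          moreover have "{x (fst q) (snd q)<..<y (fst q) (snd q)} \<subseteq> {fst (fst q)<..<snd (fst q)}"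
            "{x (fst r) (snd r)<..<y (fst r) (snd r)} \<subseteq> {fst (fst r)<..<snd (fst r)}"
            using xy[of "fst q" "snd q"] xy[of "fst r" "snd r"] q r by auto
          ultimately show ?thesis by blast
        qed
      qed
      have "(\<Sum>q\<in>?I. y (fst q) (snd q) - x (fst q) (snd q)) = (\<Sum>p\<in>P. \<Sum>i<n p. y p i - x p i)"
        by (subst sum.Sigma) (use fin in \<open>auto simp: split_def\<close>)
      also have "\<dots> \<le> (\<Sum>p\<in>P. measure lebesgue {fst p..snd p})"
      proof (intro sum_mono sum_lengths_le_measure)
        fix p i assume "p \<in> P" "i \<in> {..<n p}"
        then show "x p i \<le> y p i" "{x p i<..<y p i} \<subseteq> {fst p..snd p}" using xy[of p i] by auto
      qed (use djp in auto)
      also have "\<dots> = (\<Sum>(u,v)\<in>P. v - u)"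
        using Pd by (intro sum.cong) (force simp: split_def)+
      finally show "(\<Sum>q\<in>?I. y (fst q) (snd q) - x (fst q) (snd q)) < \<delta>" using len by simp
    qed
    then have small: "(\<Sum>p\<in>P. \<Sum>i<n p. norm (g (y p i) - g (x p i))) < e/2"
      by (subst sum.Sigma) (use fin in \<open>auto simp: split_def\<close>)
    have "(\<Sum>(u,v)\<in>P. norm (?V v - ?V u)) = (\<Sum>p\<in>P. ?V (snd p) - ?V (fst p))"
    proof (intro sum.cong refl)
      fix p assume "p \<in> P"
      then have "?V (fst p) \<le> ?V (snd p)" using Pd[of p] by (intro positive_variation_increment(1)[OF g]) auto
      then show "(case p of (u,v) \<Rightarrow> norm (?V v - ?V u)) = ?V (snd p) - ?V (fst p)" by (simp add: split_def)
    qed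
    also have "\<dots> \<le> (\<Sum>p\<in>P. (\<Sum>i<n p. norm (g (y p i) - g (x p i))) + \<eta>)"
    proof (rule sum_mono)
      fix p assume "p \<in> P"
      have "(\<Sum>i<n p. g (y p i) - g (x p i)) \<le> (\<Sum>i<n p. norm (g (y p i) - g (x p i)))"
        by (intro sum_mono) auto
      with V[OF \<open>p \<in> P\<close>] show "?V (snd p) - ?V (fst p) \<le> (\<Sum>i<n p. norm (g (y p i) - g (x p i))) + \<eta>" by simp
    qed
    also have "\<dots> = (\<Sum>p\<in>P. (\<Sum>i<n p. norm (g (y p i) - g (x p i)))) + real (card P) * \<eta>"
      by (simp add: sum.distrib)
    also have "real (card P) * \<eta> \<le> e / 2" using e by (simp add: \<eta>_def field_simps)
    finally show "(\<Sum>(u,v)\<in>P. norm (?V v - ?V u)) < e" using small by simp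
  qed
  with \<delta> show "\<exists>\<delta>>0. small_oscillation ?V a b \<delta> e" by blast
qed

text \<open>A null set has an open neighbourhood of small measure and is covered inside it by countably many
  non-overlapping closed intervals. Every finite part of this cover has small total length, hence small total
  increment of \<open>G\<close>, which is its Stieltjes measure.\<close>

lemma abs_cont_null_variation:
  fixes G :: "real \<Rightarrow> real"
  assumes ab: "a < b" and ac: "abs_cont a b G"
    and mono: "\<And>x y. x \<le> y \<Longrightarrow> G x \<le> G y" and cont: "continuous_on UNIV G"
    and N: "N \<in> null_sets lborel" "N \<subseteq> {a..b}"
  shows "emeasure (interval_measure G) N = 0"
proof -
  let ?\<nu> = "interval_measure G"
  have Icc: "emeasure ?\<nu> {c..d} = ennreal (G d - G c)" if "c \<le> d" for c d
    using emeasure_interval_measure_Icc[OF that mono cont] by simp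
  have mIcc: "measure ?\<nu> {c..d} = G d - G c" if "c \<le> d" for c d
    using Icc[OF that] mono[OF that] by (simp add: measure_def)
  have "emeasure ?\<nu> N \<le> ennreal e" if e: "e > 0" for e
  proof -
    from abs_contD[OF ac e] obtain \<delta> where \<delta>: "\<delta> > 0" "small_oscillation G a b \<delta> e" by blast
    have Nl: "N \<in> null_sets lebesgue" using N(1) by (rule null_sets_completionI)
    then obtain U where U: "open U" "N \<subseteq> U" "U - N \<in> lmeasurable" "emeasure lebesgue (U - N) < ennreal \<delta>"
      using sets_lebesgue_outer_open[OF null_setsD2[OF Nl] \<delta>(1)] by blast
    have "emeasure lebesgue U \<le> emeasure lebesgue (U - N) + emeasure lebesgue N"
      using emeasure_subadditive[of "U - N" lebesgue N] U Nl by (auto simp: Un_absorb2)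
    also have "\<dots> < ennreal \<delta>" using U(4) null_setsD1[OF Nl] by simp
    finally have eU: "emeasure lebesgue U < ennreal \<delta>" .
    have Um: "U \<in> lmeasurable"
      using order.strict_trans[OF eU ennreal_less_top] U(1) by (intro fmeasurableI) auto
    have mU: "measure lebesgue U < \<delta>"
      using eU \<delta>(1) by (simp add: emeasure_eq_measure2[OF Um] ennreal_less_iff)
    have gU: "gauge (\<lambda>x. if x \<in> U then U else UNIV)" using U(1) by (auto simp: gauge_def)
    obtain D where D: "countable D" "\<Union>D \<subseteq> cbox a b"
      and Dbox: "\<And>K. K \<in> D \<Longrightarrow> interior K \<noteq> {} \<and> (\<exists>c d. K = cbox c d)"
      and Ddis: "pairwise (\<lambda>A B. interior A \<inter> interior B = {}) D"
      and Dfine: "\<And>K. K \<in> D \<Longrightarrow> \<exists>x \<in> N \<inter> K. K \<subseteq> (if x \<in> U then U else UNIV)"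
      and NU: "N \<subseteq> \<Union>D"
    proof (rule covering_lemma[of N a b, OF _ _ gU])
      show "N \<subseteq> cbox a b" "box a b \<noteq> {}" using N(2) ab by auto
    qed blast
    have DU: "K \<subseteq> U" if K: "K \<in> D" for K
    proof -
      obtain x where "x \<in> N" "K \<subseteq> (if x \<in> U then U else UNIV)" using Dfine[OF K] by blast
      with U(2) show ?thesis by (simp add: subset_iff)
    qed
    have "\<exists>c d. {c..d} = K \<and> c < d" if "K \<in> D" for K
    proof -
      from Dbox[OF that] obtain c d where "K = {c..d}" "interior K \<noteq> {}" by auto
      then show ?thesis by (intro exI[of _ c] exI[of _ d]) (auto simp: interior_atLeastAtMost_real)
    qed
    then obtain l r where lr: "\<And>K. K \<in> D \<Longrightarrow> {l K..r K} = K" "\<And>K. K \<in> D \<Longrightarrow> l K < r K"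
      by metis
    have int: "interior K = {l K<..<r K}" if "K \<in> D" for K
      using interior_atLeastAtMost_real[of "l K" "r K"] unfolding lr(1)[OF that] .
    have bound: "measure ?\<nu> (\<Union>K\<in>D'. K) \<le> e" if D': "D' \<subseteq> D" "finite D'" for D'
    proof -
      have sub: "{l K<..<r K} \<subseteq> U" if "K \<in> D'" for K
        using D' that lr(1)[of K] DU[of K] greaterThanLessThan_subseteq_atLeastAtMost_iff by blast
      have dis: "disjoint_family_on (\<lambda>K. {l K<..<r K}) D'"
        unfolding disjoint_family_on_def
      proof (intro ballI impI)
        fix K L assume KL: "K \<in> D'" "L \<in> D'" "K \<noteq> L"
        then have "interior K \<inter> interior L = {}" using Ddis D' unfolding pairwise_def by blast
        moreover have "K \<in> D" "L \<in> D" using KL D' by auto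
        ultimately show "{l K<..<r K} \<inter> {l L<..<r L} = {}" by (simp only: int)
      qed
      have "(\<Sum>K\<in>D'. r K - l K) \<le> measure lebesgue U"
        using D' lr(2) dis Um sub by (intro sum_lengths_le_measure) (auto simp: less_imp_le subset_iff)
      then have "(\<Sum>K\<in>D'. norm (G (r K) - G (l K))) < e"
      proof (intro small_oscillation_family[OF \<delta>(2)])
        fix K assume "K \<in> D'"
        then have K: "K \<in> D" using D' by blast
        then have "{l K..r K} \<subseteq> {a..b}" using D(2) lr(1)[OF K] by auto
        then show "a \<le> l K \<and> l K \<le> r K \<and> r K \<le> b" using lr(2)[OF K] by auto
      qed (use D' dis mU in auto)
      moreover have "measure ?\<nu> (\<Union>K\<in>D'. K) \<le> (\<Sum>K\<in>D'. measure ?\<nu> K)"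
      proof (rule measure_UNION_le)
        fix K assume "K \<in> D'"
        then have "{l K..r K} = K" using lr(1) D' by blast
        moreover have "{l K..r K} \<in> sets ?\<nu>" by simp
        ultimately show "K \<in> sets ?\<nu>" by (simp only:)
      qed (use D' in auto)
      moreover have "(\<Sum>K\<in>D'. measure ?\<nu> K) \<le> (\<Sum>K\<in>D'. norm (G (r K) - G (l K)))"
      proof (rule sum_mono)
        fix K assume "K \<in> D'"
        then have K: "{l K..r K} = K" "l K < r K" using lr D' by blast+
        then have "measure ?\<nu> K = G (r K) - G (l K)" using mIcc[of "l K" "r K"] by simp
        then show "measure ?\<nu> K \<le> norm (G (r K) - G (l K))" by simp
      qed
      ultimately show ?thesis by simp
    qed
    have Kf: "K \<in> fmeasurable ?\<nu>" if "K \<in> D" for K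
    proof -
      have "{l K..r K} \<in> fmeasurable ?\<nu>"
        using lr(2)[OF that] by (intro fmeasurableI) (auto simp: Icc)
      with lr(1)[OF that] show ?thesis by simp
    qed
    have "(\<Union>K\<in>D. K) \<in> fmeasurable ?\<nu>" "measure ?\<nu> (\<Union>K\<in>D. K) \<le> e"
      by (rule fmeasurable_UN_bound[OF D(1) Kf bound] measure_UN_bound[OF D(1) Kf bound]; assumption)+
    then have "emeasure ?\<nu> (\<Union>K\<in>D. K) \<le> ennreal e"
      by (simp add: emeasure_eq_measure2 ennreal_leI)
    moreover have "emeasure ?\<nu> N \<le> emeasure ?\<nu> (\<Union>K\<in>D. K)"
      using NU \<open>(\<Union>K\<in>D. K) \<in> fmeasurable ?\<nu>\<close> by (intro emeasure_mono) auto
    ultimately show ?thesis by (rule order_trans[rotated])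
  qed
  then have "emeasure ?\<nu> N \<le> 0 + ennreal e" if "e > 0" for e using that by simp
  then have "emeasure ?\<nu> N \<le> 0" by (rule ennreal_le_epsilon)
  then show ?thesis by simp
qed

text \<open>The Stieltjes measure of an increasing absolutely continuous function is absolutely continuous with respect to
  Lebesgue measure. Its Radon-Nikodym density is the desired derivative.\<close>

lemma mono_abs_cont_density:
  fixes F :: "real \<Rightarrow> real"
  assumes ab: "a < b" and ac: "abs_cont a b F"
    and mono: "\<And>x y. a \<le> x \<Longrightarrow> x \<le> y \<Longrightarrow> y \<le> b \<Longrightarrow> F x \<le> F y"
  shows "\<exists>w. w absolutely_integrable_on {a..b} \<and> (\<forall>x\<in>{a..b}. F x - F a = integral {a..x} w)"
proof -
  \<comment> \<open>A Stieltjes measure needs an increasing continuous function on the whole line, so \<open>F\<close> is extended by constants.\<close>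
  define G where "G x = F (max a (min b x))" for x
  let ?\<nu> = "interval_measure G"
  have Gmono: "G x \<le> G y" if "x \<le> y" for x y
    unfolding G_def using ab that by (intro mono) auto
  have GF: "G x = F x" if "x \<in> {a..b}" for x using that by (auto simp: G_def)
  have Gcont: "continuous_on UNIV G"
    unfolding G_def
    by (rule continuous_on_compose2[OF abs_cont_continuous[OF ac]]) (use ab in \<open>auto intro!: continuous_intros\<close>)
  have Gac: "abs_cont a b G"
    by (rule abs_cont_cong[OF _ ac]) (simp add: GF)
  have Icc: "emeasure ?\<nu> {c..d} = ennreal (G d - G c)" if "c \<le> d" for c d
    using emeasure_interval_measure_Icc[OF that Gmono Gcont] by simp
  define \<nu> where "\<nu> = density ?\<nu> (indicator {a..b})"
  have e\<nu>: "emeasure \<nu> A = emeasure ?\<nu> (A \<inter> {a..b})" if "A \<in> sets borel" for A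
    unfolding \<nu>_def using that by (subst emeasure_density) (auto simp: indicator_inter_arith[symmetric] nn_integral_indicator mult.commute Int_commute)
  have "absolutely_continuous lborel \<nu>"
    unfolding absolutely_continuous_def
  proof
    fix N :: "real set" assume N: "N \<in> null_sets lborel"
    then have Nb: "N \<in> sets borel" by auto
    have "N \<inter> {a..b} \<in> null_sets lborel" using N by (intro null_set_Int2) auto
    then have "emeasure ?\<nu> (N \<inter> {a..b}) = 0"
      by (intro abs_cont_null_variation[OF ab Gac Gmono Gcont]) auto
    then show "N \<in> null_sets \<nu>" using Nb e\<nu> by (auto simp: null_sets_def \<nu>_def)
  qed
  then obtain f where f[measurable]: "f \<in> borel_measurable lborel" and fd: "density lborel f = \<nu>"
    using sigma_finite_measure.Radon_Nikodym[OF sigma_finite_lborel, of \<nu>] by (auto simp: \<nu>_def)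
  have nn: "(\<integral>\<^sup>+x. f x * indicator A x \<partial>lborel) = emeasure ?\<nu> (A \<inter> {a..b})" if "A \<in> sets borel" for A
    using emeasure_density[OF f, of A] that by (simp add: fd e\<nu>)
  have fin: "AE x in lborel. f x \<noteq> \<infinity>"
  proof (rule nn_integral_noteq_infinite[OF f])
    have "integral\<^sup>N lborel f = emeasure ?\<nu> (UNIV \<inter> {a..b})" using nn[of UNIV] by simp
    then show "integral\<^sup>N lborel f \<noteq> \<infinity>" using ab by (simp add: Icc)
  qed
  define w where "w x = enn2real (f x)" for x
  have w[measurable]: "w \<in> borel_measurable lborel" unfolding w_def by measurable
  have w0: "w x \<ge> 0" for x by (simp add: w_def)
  have key: "set_integrable lborel {a..x} w \<and> (LINT s:{a..x}|lborel. w s) = F x - F a" if x: "x \<in> {a..b}" for x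
  proof -
    have "(\<integral>\<^sup>+s. ennreal (indicator {a..x} s * w s) \<partial>lborel) = (\<integral>\<^sup>+s. f s * indicator {a..x} s \<partial>lborel)"
      using fin by (intro nn_integral_cong_AE) (auto simp: w_def indicator_def less_top)
    also have "\<dots> = ennreal (F x - F a)"
      using x by (subst nn) (auto simp: Int_absorb2 Icc GF)
    finally have eq: "(\<integral>\<^sup>+s. ennreal (indicator {a..x} s * w s) \<partial>lborel) = ennreal (F x - F a)" .
    have "integrable lborel (\<lambda>s. indicator {a..x} s * w s)"
      using eq by (intro integrableI_nonneg) (auto simp: w0 indicator_def)
    moreover have "(\<integral>s. indicator {a..x} s * w s \<partial>lborel) = F x - F a"
      using eq mono[of a x] x by (subst integral_eq_nn_integral) (auto simp: w0 indicator_def)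
    ultimately show ?thesis by (simp add: set_integrable_def set_lebesgue_integral_def)
  qed
  have leb: "w absolutely_integrable_on {a..x} \<and> integral {a..x} w = F x - F a" if "x \<in> {a..b}" for x
  proof -
    have b: "(\<lambda>s. indicator {a..x} s *\<^sub>R w s) \<in> borel_measurable lborel" by measurable
    have "w absolutely_integrable_on {a..x}"
      using key[OF that] unfolding set_integrable_def by (simp only: integrable_completion[OF b])
    moreover have "(LINT s:{a..x}|lebesgue. w s) = F x - F a"
      using key[OF that] unfolding set_lebesgue_integral_def by (simp only: integral_completion[OF b])
    ultimately show ?thesis using set_lebesgue_integral_eq_integral(2) by metis
  qed
  show ?thesis using leb ab by (intro exI[of _ w]) auto
qed

text \<open>Jordan decomposition: \<open>g\<close> is the difference of the increasing functions \<open>V\<close> and \<open>V - g\<close>, where \<open>V\<close> is the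
  positive variation, and both are absolutely continuous.\<close>

lemma real_abs_cont_density:
  fixes g :: "real \<Rightarrow> real"
  assumes ab: "a < b" and g: "abs_cont a b g"
  shows "\<exists>w. w absolutely_integrable_on {a..b} \<and> (\<forall>x\<in>{a..b}. g x - g a = integral {a..x} w)"
proof -
  let ?P = "positive_variation g a"
  have P: "abs_cont a b ?P" by (rule abs_cont_positive_variation[OF g])
  have Q: "abs_cont a b (\<lambda>x. ?P x - g x)" by (rule abs_cont_diff[OF P g])
  obtain p where p: "p absolutely_integrable_on {a..b}" "\<forall>x\<in>{a..b}. ?P x - ?P a = integral {a..x} p"
    using mono_abs_cont_density[OF ab P] positive_variation_increment(1)[OF g] by blast
  have "?P x - g x \<le> ?P y - g y" if "a \<le> x" "x \<le> y" "y \<le> b" for x y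
    using positive_variation_increment(2)[OF g that] by simp
  from mono_abs_cont_density[OF ab Q this]
  obtain q where q: "q absolutely_integrable_on {a..b}"
    "\<forall>x\<in>{a..b}. (?P x - g x) - (?P a - g a) = integral {a..x} q"
    by blast
  have "g x - g a = integral {a..x} (\<lambda>s. p s - q s)" if x: "x \<in> {a..b}" for x
  proof -
    have "p integrable_on {a..x}" "q integrable_on {a..x}"
      using p(1) q(1) x by (auto intro: integrable_on_subinterval[OF set_lebesgue_integral_eq_integral(1)])
    then have "integral {a..x} (\<lambda>s. p s - q s) = integral {a..x} p - integral {a..x} q"
      by (rule integral_diff)
    with bspec[OF p(2) x] bspec[OF q(2) x] show ?thesis by linarith
  qed
  moreover have "(\<lambda>s. p s - q s) absolutely_integrable_on {a..b}"
    using p(1) q(1) by (rule set_integral_diff)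
  ultimately show ?thesis by blast
qed

theorem abs_cont_imp_indefinite_integral:
  fixes f :: "real \<Rightarrow> complex"
  assumes ab: "a < b" and f: "abs_cont a b f"
  obtains w where "w absolutely_integrable_on {a..b}" "\<And>x. x \<in> {a..b} \<Longrightarrow> f x - f a = integral {a..x} w"
proof -
  have re: "abs_cont a b (\<lambda>x. Re (f x))"
    by (rule abs_cont_mono[OF f]) (simp flip: minus_complex.sel(1), rule abs_Re_le_cmod)
  have im: "abs_cont a b (\<lambda>x. Im (f x))"
    by (rule abs_cont_mono[OF f]) (simp flip: minus_complex.sel(2), rule abs_Im_le_cmod)
  obtain u where u: "u absolutely_integrable_on {a..b}" "\<forall>x\<in>{a..b}. Re (f x) - Re (f a) = integral {a..x} u"
    using real_abs_cont_density[OF ab re] by blast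
  obtain v where v: "v absolutely_integrable_on {a..b}" "\<forall>x\<in>{a..b}. Im (f x) - Im (f a) = integral {a..x} v"
    using real_abs_cont_density[OF ab im] by blast
  let ?w = "\<lambda>s. complex_of_real (u s) + \<i> * complex_of_real (v s)"
  have ul: "((\<lambda>s. complex_of_real (u s)) absolutely_integrable_on {a..b})"
    "((\<lambda>s. complex_of_real (v s)) absolutely_integrable_on {a..b})"
    using u(1) v(1) by (auto intro: absolutely_integrable_linear[OF _ bounded_linear_of_real, unfolded o_def])
  then have w: "?w absolutely_integrable_on {a..b}"
    by (intro set_integral_add) auto
  have "f x - f a = integral {a..x} ?w" if x: "x \<in> {a..b}" for x
  proof -
    have "u integrable_on {a..x}" "v integrable_on {a..x}"
      using u(1) v(1) x by (auto intro: integrable_on_subinterval[OF set_lebesgue_integral_eq_integral(1)])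
    then have "((\<lambda>s. complex_of_real (u s)) has_integral complex_of_real (integral {a..x} u)) {a..x}"
      "((\<lambda>s. complex_of_real (v s)) has_integral complex_of_real (integral {a..x} v)) {a..x}"
      by (auto intro: has_integral_linear[OF integrable_integral bounded_linear_of_real, unfolded o_def])
    then have "(?w has_integral (complex_of_real (integral {a..x} u) + \<i> * complex_of_real (integral {a..x} v))) {a..x}"
      by (intro has_integral_add has_integral_mult_right)
    then have "integral {a..x} ?w = complex_of_real (integral {a..x} u) + \<i> * complex_of_real (integral {a..x} v)"
      by (rule integral_unique)
    also have "\<dots> = f x - f a" using bspec[OF u(2) x] bspec[OF v(2) x] by (simp add: complex_eq_iff)
    finally show ?thesis by simp
  qed
  with w that show ?thesis by blast
qed

section \<open>Indefinite integrals are absolutely continuous\<close>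

text \<open>At each point the error is 0 as soon as \<open>n\<close> exceeds the value of \<open>g\<close>, and it never exceeds \<open>g\<close>.\<close>

lemma truncation_error_tendsto_0:
  fixes g :: "'a \<Rightarrow> real"
  assumes g: "integrable M g" and pos: "\<And>x. 0 \<le> g x"
  shows "(\<lambda>n. \<integral>x. g x - min (g x) (real n) \<partial>M) \<longlonglongrightarrow> 0"
proof -
  note [measurable] = borel_measurable_integrable[OF g]
  have "(\<lambda>n. \<integral>x. g x - min (g x) (real n) \<partial>M) \<longlonglongrightarrow> (\<integral>x. 0 \<partial>M)"
  proof (rule integral_dominated_convergence[where w = g])
    show "AE x in M. (\<lambda>n. g x - min (g x) (real n)) \<longlonglongrightarrow> 0"
    proof (rule AE_I2)
      fix x
      obtain N where N: "g x < real N" using reals_Archimedean2 by blast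
      have "\<forall>\<^sub>F n in sequentially. g x - min (g x) (real n) = 0"
        using eventually_ge_at_top[of N]
      proof eventually_elim
        case (elim n)
        then have "real N \<le> real n" by simp
        with N show ?case by simp
      qed
      then show "(\<lambda>n. g x - min (g x) (real n)) \<longlonglongrightarrow> 0" by (rule tendsto_eventually)
    qed
    show "AE x in M. norm (g x - min (g x) (real n)) \<le> g x" for n
      using pos by (intro AE_I2) (auto simp: min_def)
  qed (use g in auto)
  then show ?thesis by simp
qed

text \<open>Cut \<open>\<bar>f\<bar>\<close> at a height \<open>n\<close>. The part above \<open>n\<close> has small integral over the whole interval if \<open>n\<close> is
  large, and the part below contributes at most \<open>n\<close> times the total length of the family.\<close>

lemma abs_cont_indefinite_integral:
  fixes f :: "real \<Rightarrow> complex"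
  assumes f: "f absolutely_integrable_on {a..b}"
  shows "abs_cont a b (\<lambda>x. integral {a..x} f)"
  unfolding abs_cont_def
proof (intro allI impI)
  fix e :: real assume e: "e > 0"
  define g where "g s = indicator {a..b} s * norm (f s)" for s
  have gi: "integrable lebesgue g"
    using set_integrable_norm[OF f] by (simp add: set_integrable_def g_def[abs_def])
  have g0: "g s \<ge> 0" for s by (simp add: g_def)
  define h where "h n s = g s - min (g s) (real n)" for n s
  have h0: "h n s \<ge> 0" for n s by (simp add: h_def)
  have hi: "integrable lebesgue (h n)" for n
    unfolding h_def[abs_def]
    by (rule Bochner_Integration.integrable_bound[OF gi]) (use borel_measurable_integrable[OF gi] g0 in \<open>auto simp: min_def\<close>)
  have "(\<lambda>n. integral\<^sup>L lebesgue (h n)) \<longlonglongrightarrow> 0"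
    unfolding h_def by (rule truncation_error_tendsto_0[OF gi g0])
  then have "\<forall>\<^sub>F n in sequentially. integral\<^sup>L lebesgue (h n) < e/2"
    using e by (intro order_tendstoD) auto
  then obtain n where n: "integral\<^sup>L lebesgue (h n) < e/2"
    unfolding eventually_sequentially by blast
  define d where "d = e / 2 / (real n + 1)"
  have d: "d > 0" using e by (simp add: d_def)
  have piece: "norm (integral {a..y} f - integral {a..x} f)
      \<le> (\<integral>s. indicator {x<..<y} s * h n s \<partial>lebesgue) + real n * (y - x)"
    if xy: "x < y" "{x..y} \<subseteq> {a..b}" for x y
  proof -
    have ab: "a \<le> x" "y \<le> b" using xy by auto
    have fs: "f absolutely_integrable_on {x<..<y}"
      by (rule set_integrable_subset[OF f]) (use ab in auto)
    have "f integrable_on {a..y}"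
      by (rule integrable_on_subinterval[OF set_lebesgue_integral_eq_integral(1)[OF f]]) (use ab in auto)
    then have "integral {a..x} f + integral {x..y} f = integral {a..y} f"
      using xy ab by (intro Henstock_Kurzweil_Integration.integral_combine) auto
    then have "integral {a..y} f - integral {a..x} f = integral {x..y} f"
      by (simp add: algebra_simps)
    also have "\<dots> = integral {x<..<y} f" by (rule integral_open_interval_real)
    also have "\<dots> = (LINT s:{x<..<y}|lebesgue. f s)"
      using set_lebesgue_integral_eq_integral(2)[OF fs] by simp
    finally have "norm (integral {a..y} f - integral {a..x} f) \<le> (LINT s:{x<..<y}|lebesgue. norm (f s))"
      using set_integral_norm_bound[OF fs] by simp
    also have "\<dots> \<le> (\<integral>s. indicator {x<..<y} s * h n s + real n * indicator {x<..<y} s \<partial>lebesgue)"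
      unfolding set_lebesgue_integral_def
    proof (rule integral_mono)
      show "integrable lebesgue (\<lambda>s. indicator {x<..<y} s *\<^sub>R norm (f s))"
        using set_integrable_norm[OF fs] by (simp add: set_integrable_def)
      show "integrable lebesgue (\<lambda>s. indicator {x<..<y} s * h n s + real n * indicator {x<..<y} s)"
        using integrable_mult_indicator[OF _ hi[of n], of "{x<..<y}"]
        by (intro Bochner_Integration.integrable_add integrable_mult_right integrable_real_indicator) (auto simp: xy less_imp_le)
      fix s
      show "indicator {x<..<y} s *\<^sub>R norm (f s) \<le> indicator {x<..<y} s * h n s + real n * indicator {x<..<y} s"
        using ab by (auto simp: indicator_def h_def g_def min_def)
    qed
    also have "\<dots> = (\<integral>s. indicator {x<..<y} s * h n s \<partial>lebesgue) + real n * (y - x)"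
      using integrable_mult_indicator[OF _ hi[of n], of "{x<..<y}"] xy
      by (subst Bochner_Integration.integral_add) (auto simp: less_imp_le intro!: integrable_mult_right integrable_real_indicator)
    finally show ?thesis .
  qed
  have "small_oscillation (\<lambda>x. integral {a..x} f) a b d e"
    unfolding small_oscillation_def
  proof (intro allI impI, elim conjE)
    fix P :: "(real \<times> real) set"
    assume P: "finite P" "\<forall>(x, y)\<in>P. x < y \<and> {x..y} \<subseteq> {a..b}"
      and dj: "disjoint_family_on (\<lambda>(x, y). {x<..<y}) P" and len: "(\<Sum>(x, y)\<in>P. y - x) < d"
    let ?A = "\<lambda>(x, y). {x<..<y::real}"
    have "(\<Sum>(x, y)\<in>P. norm (integral {a..y} f - integral {a..x} f))
      \<le> (\<Sum>(x, y)\<in>P. (\<integral>s. indicator {x<..<y} s * h n s \<partial>lebesgue) + real n * (y - x))"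
      using P(2) by (intro sum_mono) (auto intro!: piece)
    also have "\<dots> = (\<Sum>p\<in>P. \<integral>s. indicator (?A p) s * h n s \<partial>lebesgue) + real n * (\<Sum>(x, y)\<in>P. y - x)"
      by (simp add: split_def sum.distrib sum_distrib_left)
    also have "(\<Sum>p\<in>P. \<integral>s. indicator (?A p) s * h n s \<partial>lebesgue) = (\<integral>s. (\<Sum>p\<in>P. indicator (?A p) s * h n s) \<partial>lebesgue)"
      using integrable_mult_indicator[OF _ hi[of n]]
      by (intro Bochner_Integration.integral_sum[symmetric]) (auto simp: split_def)
    also have "\<dots> \<le> integral\<^sup>L lebesgue (h n)"
    proof (rule integral_mono)
      show "integrable lebesgue (\<lambda>s. \<Sum>p\<in>P. indicator (?A p) s * h n s)"
        using integrable_mult_indicator[OF _ hi[of n]]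
        by (intro Bochner_Integration.integrable_sum) (auto simp: split_def)
      fix s
      have "(\<Sum>p\<in>P. indicator (?A p) s * h n s) = indicator (\<Union>p\<in>P. ?A p) s * h n s"
      proof -
        have "(indicator (\<Union>p\<in>P. ?A p) s :: real) = (\<Sum>p\<in>P. indicator (?A p) s)"
          by (rule indicator_UN_disjoint[OF P(1) dj])
        then show ?thesis by (simp only: sum_distrib_right)
      qed
      then show "(\<Sum>p\<in>P. indicator (?A p) s * h n s) \<le> h n s"
        using h0[of n s] by (auto simp: indicator_def)
    qed (rule hi)
    also have "\<dots> + real n * (\<Sum>(x, y)\<in>P. y - x) < e"
    proof -
      have "real n * (\<Sum>(x, y)\<in>P. y - x) \<le> real n * d" using len by (intro mult_left_mono) auto
      also have "\<dots> \<le> e/2" using e by (simp add: d_def field_simps)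
      finally show ?thesis using n by simp
    qed
    finally show "(\<Sum>(x, y)\<in>P. norm (integral {a..y} f - integral {a..x} f)) < e" by simp
  qed
  with d show "\<exists>d>0. small_oscillation (\<lambda>x. integral {a..x} f) a b d e" by blast
qed

section \<open>The convolution semigroup of Prabhakar kernels\<close>

text \<open>Log-convexity: the slope of \<open>ln \<Gamma>\<close> over \<open>[x, x+\<rho>]\<close> is at least its slope over \<open>[x-1, x]\<close>, which is
  \<open>ln (x-1)\<close> by the functional equation.\<close>

lemma Gamma_real_growth:
  fixes x \<rho> :: real
  assumes x: "x > 1" and \<rho>: "\<rho> > 0"
  shows "Gamma x * (x - 1) powr \<rho> \<le> Gamma (x + \<rho>)"
proof -
  have pos: "Gamma x > 0" "Gamma (x + \<rho>) > 0" "Gamma (x - 1) > 0"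
    using assms by (auto intro: Gamma_real_pos)
  have G: "Gamma x = (x - 1) * Gamma (x - 1)"
  proof -
    have "x - 1 \<notin> \<int>\<^sub>\<le>\<^sub>0" using x by (auto elim!: nonpos_Ints_cases)
    then show ?thesis using Gamma_plus1[of "x - 1"] by simp
  qed
  have eq: "(1 - 1/(1+\<rho>)) *\<^sub>R (x - 1) + (1/(1+\<rho>)) *\<^sub>R (x + \<rho>) = x"
  proof -
    have "(1 - c) * (x - 1) + c * (x + \<rho>) = x - 1 + c * (1 + \<rho>)" for c by (simp add: algebra_simps)
    from this[of "1/(1+\<rho>)"] show ?thesis using \<rho> by simp
  qed
  have "(ln \<circ> Gamma) ((1 - 1/(1+\<rho>)) *\<^sub>R (x - 1) + (1/(1+\<rho>)) *\<^sub>R (x + \<rho>))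
      \<le> (1 - 1/(1+\<rho>)) * (ln \<circ> Gamma) (x - 1) + (1/(1+\<rho>)) * (ln \<circ> Gamma) (x + \<rho>)"
    by (rule convex_onD[OF log_convex_Gamma_real]) (use assms in auto)
  then have "ln (Gamma x) \<le> (1 - 1/(1+\<rho>)) * ln (Gamma (x - 1)) + (1/(1+\<rho>)) * ln (Gamma (x + \<rho>))"
    unfolding eq by simp
  then have "(1+\<rho>) * ln (Gamma x) \<le> (1+\<rho>) * ((1 - 1/(1+\<rho>)) * ln (Gamma (x - 1)) + (1/(1+\<rho>)) * ln (Gamma (x + \<rho>)))"
    using \<rho> by (intro mult_left_mono) auto
  also have "\<dots> = \<rho> * ln (Gamma (x - 1)) + ln (Gamma (x + \<rho>))"
  proof -
    have "(1+\<rho>) * ((1 - c) * A + c * B) = (1 + \<rho> - c * (1 + \<rho>)) * A + c * (1 + \<rho>) * B" for c A B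
      by (simp add: algebra_simps)
    from this[of "1/(1+\<rho>)"] show ?thesis using \<rho> by simp
  qed
  finally have "(1+\<rho>) * ln (Gamma x) \<le> \<rho> * ln (Gamma (x - 1)) + ln (Gamma (x + \<rho>))" .
  moreover have "ln (Gamma x) = ln (x - 1) + ln (Gamma (x - 1))"
    unfolding G using x pos by (intro ln_mult_pos) auto
  ultimately have "ln (Gamma x) + \<rho> * ln (x - 1) \<le> ln (Gamma (x + \<rho>))"
    by (simp add: algebra_simps)
  then have "exp (ln (Gamma x) + \<rho> * ln (x - 1)) \<le> exp (ln (Gamma (x + \<rho>)))"
    by simp
  then show ?thesis using pos x by (simp add: exp_add powr_def)
qed

definition ml_coeff :: "real \<Rightarrow> real \<Rightarrow> complex \<Rightarrow> nat \<Rightarrow> complex" where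
  "ml_coeff \<rho> \<mu> \<gamma> n = pochhammer \<gamma> n / (fact n * Gamma (of_real (\<rho> * real n + \<mu>)))"

lemma mittag_leffler_eq: "mittag_leffler \<rho> \<mu> \<gamma> z = (\<Sum>n. ml_coeff \<rho> \<mu> \<gamma> n * z ^ n)"
  by (simp add: mittag_leffler_def ml_coeff_def)

text \<open>In the ratio test the Pochhammer factors contribute a bounded quotient, and
  \<open>\<Gamma>(x) / \<Gamma>(x+\<rho>)\<close> tends to 0 at \<open>x = \<rho> n + \<mu>\<close> by the growth of \<open>\<Gamma>\<close>. So the series converges for every argument.\<close>

lemma summable_ml_coeff:
  assumes \<rho>: "\<rho> > 0" and \<mu>: "\<mu> > 0" and r: "r \<ge> 0"
  shows "summable (\<lambda>n. norm (ml_coeff \<rho> \<mu> \<gamma> n) * r ^ n)"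
proof -
  define K where "K = 2 * ((norm \<gamma> + 1) * r) + 1"
  have K: "K > 0" using r by (simp add: K_def add_nonneg_pos)
  \<comment> \<open>Chosen so that \<open>(x - 1) powr \<rho>\<close> exceeds \<open>2 (\<bar>\<gamma>\<bar> + 1) r\<close> once \<open>x - 1 > M\<close>, which makes the quotient
    of consecutive terms at most 1/2.\<close>
  define M where "M = K powr (1/\<rho>)"
  obtain N where N: "(M + 1) / \<rho> < real N" using reals_Archimedean2 by blast
  show ?thesis
  proof (rule summable_ratio_test[where c = "1/2" and N = N])
    fix n assume n: "n \<ge> N"
    define x where "x = \<rho> * real n + \<mu>"
    have "M + 1 < \<rho> * real N" using N \<rho> by (simp add: field_simps)
    also have "\<dots> \<le> \<rho> * real n" using n \<rho> by simp
    finally have xM: "x - 1 > M" using \<mu> by (simp add: x_def)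
    have M0: "M > 0" using K by (simp add: M_def)
    have x1: "x > 1" using xM M0 by simp
    have "K = M powr \<rho>"
      using \<rho> K by (simp add: M_def powr_powr)
    also have "\<dots> \<le> (x - 1) powr \<rho>" using xM M0 \<rho> by (intro powr_mono2) auto
    finally have big: "2 * ((norm \<gamma> + 1) * r) \<le> (x - 1) powr \<rho>" by (simp add: K_def)
    have Gp: "Gamma x > 0" "Gamma (x + \<rho>) > 0" using x1 \<rho> by (auto intro: Gamma_real_pos)
    have "2 * ((norm \<gamma> + 1) * r) * Gamma x \<le> (x - 1) powr \<rho> * Gamma x"
      using big Gp by (intro mult_right_mono) auto
    also have "\<dots> \<le> Gamma (x + \<rho>)" using Gamma_real_growth[OF x1 \<rho>] by (simp add: mult.commute)
    finally have grow: "2 * ((norm \<gamma> + 1) * r) * Gamma x \<le> Gamma (x + \<rho>)" .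
    have x': "\<rho> * real (Suc n) + \<mu> = x + \<rho>" by (simp add: x_def algebra_simps)
    have c1: "norm (ml_coeff \<rho> \<mu> \<gamma> n) = norm (pochhammer \<gamma> n) / (fact n * Gamma x)"
      unfolding ml_coeff_def x_def[symmetric] using Gp
      by (simp add: Gamma_complex_of_real norm_divide norm_mult)
    have c2: "norm (ml_coeff \<rho> \<mu> \<gamma> (Suc n)) =
        norm (pochhammer \<gamma> n) / fact n * (norm (\<gamma> + of_nat n) / real (Suc n)) / Gamma (x + \<rho>)"
      unfolding ml_coeff_def x' Gamma_complex_of_real using Gp
      by (simp add: norm_divide norm_mult pochhammer_Suc mult.commute del: of_nat_Suc)
    have "norm (\<gamma> + of_nat n) \<le> norm \<gamma> + real n" by (rule norm_triangle_le) simp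
    also have "\<dots> \<le> (norm \<gamma> + 1) * real (Suc n)" by (simp add: algebra_simps)
    finally have le: "norm (\<gamma> + of_nat n) / real (Suc n) \<le> norm \<gamma> + 1" by (simp add: divide_le_eq)
    have "norm (ml_coeff \<rho> \<mu> \<gamma> (Suc n)) * r
       \<le> norm (pochhammer \<gamma> n) / fact n * (norm \<gamma> + 1) / Gamma (x + \<rho>) * r"
      unfolding c2 using le Gp r by (intro mult_right_mono divide_right_mono mult_left_mono) auto
    also have "\<dots> = norm (pochhammer \<gamma> n) / fact n * ((norm \<gamma> + 1) * r / Gamma (x + \<rho>))" by simp
    also have "\<dots> \<le> norm (pochhammer \<gamma> n) / fact n * (1/2 / Gamma x)"
      using grow Gp by (intro mult_left_mono) (simp_all add: field_simps)
    also have "\<dots> = 1/2 * norm (ml_coeff \<rho> \<mu> \<gamma> n)"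
      unfolding c1 by simp
    finally have main: "norm (ml_coeff \<rho> \<mu> \<gamma> (Suc n)) * r \<le> 1/2 * norm (ml_coeff \<rho> \<mu> \<gamma> n)" .
    have "norm (norm (ml_coeff \<rho> \<mu> \<gamma> (Suc n)) * r ^ Suc n) = (norm (ml_coeff \<rho> \<mu> \<gamma> (Suc n)) * r) * r ^ n"
      using r by (simp add: abs_mult)
    also have "\<dots> \<le> (1/2 * norm (ml_coeff \<rho> \<mu> \<gamma> n)) * r ^ n"
      using main r by (intro mult_right_mono) auto
    also have "\<dots> = 1/2 * norm (norm (ml_coeff \<rho> \<mu> \<gamma> n) * r ^ n)" using r by (simp add: abs_mult)
    finally show "norm (norm (ml_coeff \<rho> \<mu> \<gamma> (Suc n)) * r ^ Suc n) \<le> 1/2 * norm (norm (ml_coeff \<rho> \<mu> \<gamma> n) * r ^ n)" .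
  qed simp
qed

text \<open>The maximum of the Mittag-Leffler function over a disc is bounded by the series of absolute values at its radius;
  this number is the constant in all bounds of the kernels.\<close>

definition ml_majorant :: "real \<Rightarrow> real \<Rightarrow> complex \<Rightarrow> real \<Rightarrow> real" where
  "ml_majorant \<rho> \<mu> \<gamma> r = (\<Sum>n. norm (ml_coeff \<rho> \<mu> \<gamma> n) * r ^ n)"

lemma summable_ml_terms:
  assumes "\<rho> > 0" "\<mu> > 0"
  shows "summable (\<lambda>n. norm (ml_coeff \<rho> \<mu> \<gamma> n * z ^ n))"
  using summable_ml_coeff[OF assms, of "norm z" \<gamma>] by (simp add: norm_mult norm_power)

lemma norm_mittag_leffler_le:
  assumes "\<rho> > 0" "\<mu> > 0" "norm z \<le> r"
  shows "norm (mittag_leffler \<rho> \<mu> \<gamma> z) \<le> ml_majorant \<rho> \<mu> \<gamma> r"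
proof -
  have r: "r \<ge> 0" using assms(3) norm_ge_zero order_trans by blast
  have "norm (mittag_leffler \<rho> \<mu> \<gamma> z) \<le> (\<Sum>n. norm (ml_coeff \<rho> \<mu> \<gamma> n * z ^ n))"
    unfolding mittag_leffler_eq by (rule summable_norm[OF summable_ml_terms[OF assms(1,2)]])
  also have "\<dots> \<le> ml_majorant \<rho> \<mu> \<gamma> r"
    unfolding ml_majorant_def
    by (intro suminf_le summable_ml_terms summable_ml_coeff assms r)
       (auto simp: norm_mult norm_power intro!: mult_left_mono power_mono assms)
  finally show ?thesis .
qed

definition prabhakar_kernel :: "real \<Rightarrow> real \<Rightarrow> complex \<Rightarrow> complex \<Rightarrow> real \<Rightarrow> complex" where
  "prabhakar_kernel \<rho> \<mu> \<gamma> \<omega> u =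
     of_real (u powr (\<mu> - 1)) * mittag_leffler \<rho> \<mu> \<gamma> (\<omega> * of_real (u powr \<rho>))"

lemma borel_measurable_prabhakar_kernel [measurable]:
  "prabhakar_kernel \<rho> \<mu> \<gamma> \<omega> \<in> borel_measurable borel"
  unfolding prabhakar_kernel_def mittag_leffler_eq by measurable

lemma norm_prabhakar_kernel_le:
  assumes "\<rho> > 0" "\<mu> > 0" "0 < u" "u \<le> T"
  shows "norm (prabhakar_kernel \<rho> \<mu> \<gamma> \<omega> u) \<le> ml_majorant \<rho> \<mu> \<gamma> (norm \<omega> * T powr \<rho>) * u powr (\<mu> - 1)"
proof -
  have "norm (\<omega> * of_real (u powr \<rho>)) \<le> norm \<omega> * T powr \<rho>"
    using assms by (auto simp: norm_mult intro!: mult_left_mono powr_mono2)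
  from norm_mittag_leffler_le[OF assms(1,2) this, of \<gamma>] show ?thesis
    unfolding prabhakar_kernel_def by (simp add: norm_mult mult.commute mult_left_mono)
qed

text \<open>The substitution \<open>s = t x\<close> reduces this to Euler's integral over \<open>[0,1]\<close>.\<close>

lemma integral_Beta_interval:
  fixes p q t :: real
  assumes p: "p > 0" and q: "q > 0" and t: "t > 0"
  shows "has_bochner_integral lborel (\<lambda>s. indicator {0<..<t} s * ((t - s) powr (p - 1) * s powr (q - 1)))
           (Beta p q * t powr (p + q - 1))"
proof -
  let ?\<beta> = "\<lambda>s. indicator {0<..<1} s * ((1 - s) powr (p - 1) * s powr (q - 1))"
  have "((\<lambda>s. s powr (q - 1) * (1 - s) powr (p - 1)) has_integral Beta q p) {0..1}"
    by (rule has_integral_Beta_real[OF q p])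
  then have h: "((\<lambda>s. (1 - s) powr (p - 1) * s powr (q - 1)) has_integral Beta p q) {0<..<1}"
    by (simp add: has_integral_Icc_iff_Ioo Beta_commute mult.commute)
  have ai: "(\<lambda>s. (1 - s) powr (p - 1) * s powr (q - 1)) absolutely_integrable_on {0<..<1}"
    using h by (intro nonnegative_absolutely_integrable_1) (auto simp: integrable_on_def)
  have b: "?\<beta> \<in> borel_measurable lborel" by measurable
  have "integrable lebesgue ?\<beta>" using ai by (simp add: set_integrable_def)
  then have i: "integrable lborel ?\<beta>" by (simp only: integrable_completion[OF b])
  have "integral\<^sup>L lborel ?\<beta> = integral\<^sup>L lebesgue ?\<beta>" by (rule integral_completion[OF b, symmetric])
  also have "\<dots> = Beta p q"
    using set_lebesgue_integral_eq_integral(2)[OF ai] integral_unique[OF h]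
    by (simp add: set_lebesgue_integral_def)
  finally have "has_bochner_integral lborel ?\<beta> (Beta p q)" using i by (simp add: has_bochner_integral_iff)
  then have "has_bochner_integral lborel (\<lambda>s. t powr (p + q - 2) * ?\<beta> s) (t powr (p + q - 2) * Beta p q)"
    by (rule has_bochner_integral_mult_right)
  also have "(\<lambda>s. t powr (p + q - 2) * ?\<beta> s) =
      (\<lambda>s. indicator {0<..<t} (0 + t * s) * ((t - (0 + t * s)) powr (p - 1) * (0 + t * s) powr (q - 1)))"
  proof
    fix s :: real
    show "t powr (p + q - 2) * ?\<beta> s =
      indicator {0<..<t} (0 + t * s) * ((t - (0 + t * s)) powr (p - 1) * (0 + t * s) powr (q - 1))"
    proof (cases "0 < s \<and> s < 1")
      case True
      have "t - t * s = t * (1 - s)" by (simp add: algebra_simps)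
      moreover have "t powr (p + q - 2) = t powr (p - 1) * t powr (q - 1)"
        by (simp add: powr_add[symmetric])
      ultimately show ?thesis using True t by (simp add: powr_mult indicator_def)
    next
      case False
      then show ?thesis using t by (auto simp: indicator_def zero_less_mult_iff)
    qed
  qed
  finally have "has_bochner_integral lborel
      (\<lambda>s. indicator {0<..<t} s * ((t - s) powr (p - 1) * s powr (q - 1)))
      (t *\<^sub>R (t powr (p + q - 2) * Beta p q))"
    using t by (subst lborel_has_bochner_integral_real_affine_iff[where c = t and t = 0])
      (simp_all add: mult.assoc[symmetric])
  moreover have "t * t powr (p + q - 2) = t powr (p + q - 1)"
    using t powr_mult_base[of t "p+q-2"] by (simp add: algebra_simps)
  then have "t *\<^sub>R (t powr (p + q - 2) * Beta p q) = Beta p q * t powr (p + q - 1)"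
    by (metis mult.assoc mult.commute real_scaleR_def)
  ultimately show ?thesis by (simp only:)
qed

text \<open>The Beta function replaces the two Gamma factors in the denominators by a single one that does not depend on \<open>i\<close>.
  What is left is the Vandermonde identity for rising factorials.\<close>

lemma ml_coeff_convolution:
  assumes "\<rho> > 0" "a > 0" "b > 0"
  shows "(\<Sum>i\<le>N. ml_coeff \<rho> a \<gamma> i * ml_coeff \<rho> b \<delta> (N - i) *
            of_real (Beta (\<rho> * real i + a) (\<rho> * real (N - i) + b))) = ml_coeff \<rho> (a + b) (\<gamma> + \<delta>) N"
proof -
  let ?G = "complex_of_real (Gamma (\<rho> * real N + (a + b)))"
  have "ml_coeff \<rho> a \<gamma> i * ml_coeff \<rho> b \<delta> (N - i) * of_real (Beta (\<rho> * real i + a) (\<rho> * real (N - i) + b))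
      = of_nat (N choose i) * pochhammer \<gamma> i * pochhammer \<delta> (N - i) / (fact N * ?G)" if "i \<le> N" for i
  proof -
    have pos: "Gamma (\<rho> * real i + a) > 0" "Gamma (\<rho> * real (N - i) + b) > 0"
      using assms by (auto intro!: Gamma_real_pos add_nonneg_pos)
    have ar: "\<rho> * real i + a + (\<rho> * real (N - i) + b) = \<rho> * real N + (a + b)"
      using that by (simp add: of_nat_diff algebra_simps)
    have "complex_of_real (Beta (\<rho> * real i + a) (\<rho> * real (N - i) + b)) =
        of_real (Gamma (\<rho> * real i + a)) * of_real (Gamma (\<rho> * real (N - i) + b)) / ?G"
      unfolding Beta_def ar by simp
    moreover have "(of_nat (N choose i) :: complex) = fact N / (fact i * fact (N - i))"
      using that by (rule binomial_fact)
    ultimately show ?thesis unfolding ml_coeff_def Gamma_complex_of_real using pos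
      by (simp only:) (simp add: field_simps)
  qed
  then have "(\<Sum>i\<le>N. ml_coeff \<rho> a \<gamma> i * ml_coeff \<rho> b \<delta> (N - i) *
            of_real (Beta (\<rho> * real i + a) (\<rho> * real (N - i) + b))) =
      (\<Sum>i\<le>N. of_nat (N choose i) * pochhammer \<gamma> i * pochhammer \<delta> (N - i)) / (fact N * ?G)"
    by (simp add: sum_divide_distrib)
  also have "\<dots> = ml_coeff \<rho> (a + b) (\<gamma> + \<delta>) N"
    by (simp add: ml_coeff_def pochhammer_binomial_sum flip: Gamma_complex_of_real)
  finally show ?thesis .
qed

text \<open>By the Cauchy product the integrand is \<open>(t-s)\<^bsup>a-1\<^esup> s\<^bsup>b-1\<^esup>\<close> times a single series, whose
  partial sums are bounded by the product of the two majorants. Dominated convergence allows termwise integration, and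
  each term is a finite sum of Beta integrals.\<close>

theorem prabhakar_kernel_convolution:
  assumes \<rho>: "\<rho> > 0" and a: "a > 0" and b: "b > 0" and t: "t > 0"
  shows "(\<integral>s. indicator {0<..<t} s *\<^sub>R (prabhakar_kernel \<rho> a \<gamma> \<omega> (t - s) * prabhakar_kernel \<rho> b \<delta> \<omega> s) \<partial>lborel)
       = prabhakar_kernel \<rho> (a + b) (\<gamma> + \<delta>) \<omega> t"
proof -
  let ?A = "ml_coeff \<rho> a \<gamma>" and ?B = "ml_coeff \<rho> b \<delta>"
  define w where "w s = indicator {0<..<t} s * ((t - s) powr (a - 1) * s powr (b - 1))" for s
  \<comment> \<open>The terms of the Cauchy product of the two Mittag-Leffler series.\<close>
  define h where "h N s = (\<Sum>i\<le>N. ?A i * (\<omega> * of_real ((t - s) powr \<rho>)) ^ i *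
      (?B (N - i) * (\<omega> * of_real (s powr \<rho>)) ^ (N - i)))" for N s
  define S where "S M s = w s *\<^sub>R (\<Sum>N<M. h N s)" for M s
  define F where "F s = w s *\<^sub>R (mittag_leffler \<rho> a \<gamma> (\<omega> * of_real ((t - s) powr \<rho>)) *
      mittag_leffler \<rho> b \<delta> (\<omega> * of_real (s powr \<rho>)))" for s
  define X where "X = norm \<omega> * t powr \<rho>"
  have X: "X \<ge> 0" by (simp add: X_def)
  define C where "C = ml_majorant \<rho> a \<gamma> X * ml_majorant \<rho> b \<delta> X"
  have w0: "w s \<ge> 0" for s by (simp add: w_def)
  have wint: "integrable lborel w"
    using integral_Beta_interval[OF a b t] unfolding w_def has_bochner_integral_iff by blast
  have Fm: "F \<in> borel_measurable lborel"
    unfolding F_def w_def mittag_leffler_eq by measurable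
  have Sm: "S M \<in> borel_measurable lborel" for M
    unfolding S_def w_def h_def by measurable
  have lim: "(\<lambda>M. S M s) \<longlonglongrightarrow> F s" for s
  proof -
    have "(\<lambda>N. h N s) sums (mittag_leffler \<rho> a \<gamma> (\<omega> * of_real ((t - s) powr \<rho>)) *
      mittag_leffler \<rho> b \<delta> (\<omega> * of_real (s powr \<rho>)))"
      unfolding h_def mittag_leffler_eq
      by (rule Cauchy_product_sums[OF summable_ml_terms[OF \<rho> a] summable_ml_terms[OF \<rho> b]])
    then show ?thesis unfolding S_def F_def sums_def by (intro tendsto_scaleR tendsto_const)
  qed
  have bnd: "norm (S M s) \<le> C * w s" for M s
  proof (cases "0 < s \<and> s < t")
    case False
    then show ?thesis by (auto simp: S_def w_def indicator_def)
  next
    case True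
    let ?\<alpha> = "\<lambda>i. norm (?A i) * X ^ i" and ?\<beta> = "\<lambda>i. norm (?B i) * X ^ i"
    have x1: "norm \<omega> * (t - s) powr \<rho> \<le> X" and x2: "norm \<omega> * s powr \<rho> \<le> X"
      unfolding X_def using True \<rho> by (auto intro!: mult_left_mono powr_mono2)
    have "norm (h N s) \<le> (\<Sum>i\<le>N. ?\<alpha> i * ?\<beta> (N - i))" for N
      unfolding h_def
    proof (rule sum_norm_le)
      fix i
      have "norm (?A i * (\<omega> * of_real ((t - s) powr \<rho>)) ^ i) \<le> ?\<alpha> i"
        "norm (?B (N - i) * (\<omega> * of_real (s powr \<rho>)) ^ (N - i)) \<le> ?\<beta> (N - i)"
        using x1 x2 by (auto simp: norm_mult norm_power intro!: mult_left_mono power_mono)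
      then show "norm (?A i * (\<omega> * of_real ((t - s) powr \<rho>)) ^ i *
          (?B (N - i) * (\<omega> * of_real (s powr \<rho>)) ^ (N - i))) \<le> ?\<alpha> i * ?\<beta> (N - i)"
        unfolding norm_mult[of "_ * _" "_ * _"] using X by (intro mult_mono) auto
    qed
    then have "norm (\<Sum>N<M. h N s) \<le> (\<Sum>N<M. \<Sum>i\<le>N. ?\<alpha> i * ?\<beta> (N - i))"
      by (intro sum_norm_le)
    also have "\<dots> \<le> (\<Sum>N. \<Sum>i\<le>N. ?\<alpha> i * ?\<beta> (N - i))"
    proof (rule sum_le_suminf)
      show "summable (\<lambda>N. \<Sum>i\<le>N. ?\<alpha> i * ?\<beta> (N - i))"
        using summable_ml_coeff[OF \<rho> a X, of \<gamma>] summable_ml_coeff[OF \<rho> b X, of \<delta>] X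
        by (intro summable_Cauchy_product) (simp_all add: abs_mult)
    qed (use X in \<open>auto intro!: sum_nonneg mult_nonneg_nonneg\<close>)
    also have "\<dots> = C"
      unfolding C_def ml_majorant_def
      using summable_ml_coeff[OF \<rho> a X, of \<gamma>] summable_ml_coeff[OF \<rho> b X, of \<delta>] X
      by (intro Cauchy_product[symmetric]) (simp_all add: abs_mult)
    finally have "w s * norm (\<Sum>N<M. h N s) \<le> w s * C" using w0[of s] by (rule mult_left_mono)
    then show ?thesis using w0[of s] by (simp add: S_def mult.commute)
  qed
  have conv: "(\<lambda>M. integral\<^sup>L lborel (S M)) \<longlonglongrightarrow> integral\<^sup>L lborel F"
    by (rule integral_dominated_convergence[OF Fm Sm, where w = "\<lambda>s. C * w s"])
       (use wint lim bnd in auto)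
  have monomial: "has_bochner_integral lborel (\<lambda>s. w s *\<^sub>R (?A i * (\<omega> * of_real ((t - s) powr \<rho>)) ^ i *
      (?B j * (\<omega> * of_real (s powr \<rho>)) ^ j)))
      (?A i * ?B j * of_real (Beta (\<rho> * real i + a) (\<rho> * real j + b)) *
        (of_real (t powr (a + b - 1)) * (\<omega> * of_real (t powr \<rho>)) ^ (i + j)))" for i j
  proof -
    have pq: "\<rho> * real i + a > 0" "\<rho> * real j + b > 0" using \<rho> a b by (auto intro: add_nonneg_pos)
    have pw: "x powr (c - 1) * (x powr \<rho>) ^ k = x powr (\<rho> * real k + c - 1)" if "x > 0" for x c k
    proof -
      have "(x powr \<rho>) ^ k = x powr (\<rho> * real k)" using that by (simp add: powr_powr flip: powr_realpow)
      moreover have "c - 1 + \<rho> * real k = \<rho> * real k + c - 1" by simp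
      ultimately show ?thesis by (simp only: flip: powr_add)
    qed
    have "has_bochner_integral lborel (\<lambda>s. ?A i * ?B j * \<omega> ^ (i + j) * complex_of_real
       (indicator {0<..<t} s * ((t - s) powr (\<rho> * real i + a - 1) * s powr (\<rho> * real j + b - 1))))
       (?A i * ?B j * \<omega> ^ (i + j) * complex_of_real (Beta (\<rho> * real i + a) (\<rho> * real j + b) *
           t powr (\<rho> * real i + a + (\<rho> * real j + b) - 1)))"
      by (intro has_bochner_integral_mult_right has_bochner_integral_of_real integral_Beta_interval[OF pq t])
    also have "(\<lambda>s. ?A i * ?B j * \<omega> ^ (i + j) * complex_of_real
       (indicator {0<..<t} s * ((t - s) powr (\<rho> * real i + a - 1) * s powr (\<rho> * real j + b - 1)))) =
       (\<lambda>s. w s *\<^sub>R (?A i * (\<omega> * of_real ((t - s) powr \<rho>)) ^ i * (?B j * (\<omega> * of_real (s powr \<rho>)) ^ j)))"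
    proof
      fix s
      show "?A i * ?B j * \<omega> ^ (i + j) * complex_of_real
       (indicator {0<..<t} s * ((t - s) powr (\<rho> * real i + a - 1) * s powr (\<rho> * real j + b - 1))) =
        w s *\<^sub>R (?A i * (\<omega> * of_real ((t - s) powr \<rho>)) ^ i * (?B j * (\<omega> * of_real (s powr \<rho>)) ^ j))"
      proof (cases "0 < s \<and> s < t")
        case True
        then have p: "(t - s) powr (\<rho> * real i + a - 1) = (t - s) powr (a - 1) * ((t - s) powr \<rho>) ^ i"
          "s powr (\<rho> * real j + b - 1) = s powr (b - 1) * (s powr \<rho>) ^ j"
          by (simp_all add: pw)
        show ?thesis using True unfolding p w_def
          by (simp add: scaleR_conv_of_real power_mult_distrib power_add mult_ac)
      qed (auto simp: w_def indicator_def)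
    qed
    also have "?A i * ?B j * \<omega> ^ (i + j) * complex_of_real (Beta (\<rho> * real i + a) (\<rho> * real j + b) *
           t powr (\<rho> * real i + a + (\<rho> * real j + b) - 1)) =
       ?A i * ?B j * of_real (Beta (\<rho> * real i + a) (\<rho> * real j + b)) *
        (of_real (t powr (a + b - 1)) * (\<omega> * of_real (t powr \<rho>)) ^ (i + j))"
    proof -
      have "\<rho> * real i + a + (\<rho> * real j + b) - 1 = \<rho> * real (i + j) + (a + b) - 1"
        by (simp add: algebra_simps)
      then have "t powr (\<rho> * real i + a + (\<rho> * real j + b) - 1) = t powr (a + b - 1) * (t powr \<rho>) ^ (i + j)"
        by (simp only: pw[OF t])
      then show ?thesis by (simp add: power_mult_distrib mult_ac)
    qed
    finally show ?thesis .
  qed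
  have intS: "integral\<^sup>L lborel (S M) = of_real (t powr (a + b - 1)) *
      (\<Sum>N<M. ml_coeff \<rho> (a + b) (\<gamma> + \<delta>) N * (\<omega> * of_real (t powr \<rho>)) ^ N)" for M
  proof -
    have "has_bochner_integral lborel (\<lambda>s. \<Sum>N<M. \<Sum>i\<le>N. w s *\<^sub>R (?A i * (\<omega> * of_real ((t - s) powr \<rho>)) ^ i *
         (?B (N - i) * (\<omega> * of_real (s powr \<rho>)) ^ (N - i))))
      (\<Sum>N<M. \<Sum>i\<le>N. ?A i * ?B (N - i) * of_real (Beta (\<rho> * real i + a) (\<rho> * real (N - i) + b)) *
        (of_real (t powr (a + b - 1)) * (\<omega> * of_real (t powr \<rho>)) ^ (i + (N - i))))"
      by (intro has_bochner_integral_sum monomial)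
    then have "integral\<^sup>L lborel (S M) = (\<Sum>N<M. \<Sum>i\<le>N. ?A i * ?B (N - i) *
        of_real (Beta (\<rho> * real i + a) (\<rho> * real (N - i) + b)) *
        (of_real (t powr (a + b - 1)) * (\<omega> * of_real (t powr \<rho>)) ^ (i + (N - i))))"
      unfolding S_def h_def scaleR_sum_right by (rule has_bochner_integral_integral_eq)
    also have "\<dots> = (\<Sum>N<M. (\<Sum>i\<le>N. ?A i * ?B (N - i) *
        of_real (Beta (\<rho> * real i + a) (\<rho> * real (N - i) + b))) *
        (of_real (t powr (a + b - 1)) * (\<omega> * of_real (t powr \<rho>)) ^ N))"
      unfolding sum_distrib_right by (intro sum.cong refl) simp
    also have "\<dots> = of_real (t powr (a + b - 1)) *
      (\<Sum>N<M. ml_coeff \<rho> (a + b) (\<gamma> + \<delta>) N * (\<omega> * of_real (t powr \<rho>)) ^ N)"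
      unfolding ml_coeff_convolution[OF \<rho> a b] sum_distrib_left by (intro sum.cong refl) (simp add: mult_ac)
    finally show ?thesis .
  qed
  have "(\<lambda>M. integral\<^sup>L lborel (S M)) \<longlonglongrightarrow> prabhakar_kernel \<rho> (a + b) (\<gamma> + \<delta>) \<omega> t"
    unfolding intS prabhakar_kernel_def mittag_leffler_eq using \<rho> a b
    by (intro tendsto_mult tendsto_const summable_LIMSEQ summable_norm_cancel[OF summable_ml_terms]) auto
  with conv have "integral\<^sup>L lborel F = prabhakar_kernel \<rho> (a + b) (\<gamma> + \<delta>) \<omega> t"
    by (rule LIMSEQ_unique)
  moreover have "F = (\<lambda>s. indicator {0<..<t} s *\<^sub>R (prabhakar_kernel \<rho> a \<gamma> \<omega> (t - s) * prabhakar_kernel \<rho> b \<delta> \<omega> s))"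
    by (auto simp: F_def w_def prabhakar_kernel_def indicator_def scaleR_conv_of_real mult_ac)
  ultimately show ?thesis by simp
qed

section \<open>Volterra integrals with power-bounded kernels\<close>

text \<open>Prabhakar integrals and iterated integrals are both of this form, so that composition needs to be treated
  only once.\<close>

definition volterra :: "(real \<Rightarrow> complex) \<Rightarrow> (real \<Rightarrow> complex) \<Rightarrow> real \<Rightarrow> complex" where
  "volterra K f t = (LINT s:{0..t}|lebesgue. K (t - s) * f s)"

text \<open>Fubini's theorem is applied to Borel functions on the product space, whereas integrability with respect to the
  completed measure only gives Lebesgue measurability.\<close>

lemma borel_representative:
  fixes f :: "real \<Rightarrow> complex"
  assumes f: "f absolutely_integrable_on S"
  obtains g where "g \<in> borel_measurable borel" "integrable lborel g" "AE s in lborel. s \<in> S \<longrightarrow> f s = g s"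
proof -
  let ?F = "\<lambda>s. indicator S s *\<^sub>R f s"
  have F: "integrable lebesgue ?F" using f by (simp add: set_integrable_def)
  then have Fm: "?F \<in> borel_measurable lebesgue" by (rule borel_measurable_integrable)
  have "(\<lambda>s. Re (?F s)) \<in> borel_measurable lebesgue \<and> (\<lambda>s. Im (?F s)) \<in> borel_measurable lebesgue"
    using Fm by (rule borel_measurable_complex_iff[THEN iffD1])
  then have re: "(\<lambda>s. Re (?F s)) \<in> borel_measurable lebesgue" and im: "(\<lambda>s. Im (?F s)) \<in> borel_measurable lebesgue"
    by blast+
  obtain u where u: "u \<in> borel_measurable lborel" "AE s in lborel. Re (?F s) = u s"
    using completion_ex_borel_measurable_real[OF re] by blast
  obtain v where v: "v \<in> borel_measurable lborel" "AE s in lborel. Im (?F s) = v s"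
    using completion_ex_borel_measurable_real[OF im] by blast
  define g where "g s = Complex (u s) (v s)" for s
  have gb: "g \<in> borel_measurable borel"
    using u(1) v(1) by (subst borel_measurable_complex_iff) (simp add: g_def)
  have aeg: "AE s in lborel. ?F s = g s"
    using u(2) v(2) by eventually_elim (simp add: g_def complex_eq_iff)
  then have ael: "AE s in lebesgue. ?F s = g s" by (rule AE_completion)
  have "g \<in> borel_measurable lebesgue" using gb by (intro measurable_completion) simp
  then have "integrable lebesgue g"
    using F integrable_cong_AE[OF Fm _ ael] by blast
  then have "integrable lborel g" using integrable_completion[of g lborel] gb by simp
  moreover have "AE s in lborel. s \<in> S \<longrightarrow> f s = g s" using aeg by eventually_elim auto
  ultimately show ?thesis using that gb by blast
qed

lemma volterra_representative:
  assumes K: "K \<in> borel_measurable borel" and g: "g \<in> borel_measurable borel"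
    and ae: "AE s in lborel. s \<in> {0<..<T} \<longrightarrow> f s = g s" and t: "t \<le> T"
  shows "volterra K f t = (\<integral>s. indicator {0<..<t} s *\<^sub>R (K (t - s) * g s) \<partial>lborel)"
proof -
  let ?H = "\<lambda>s. indicator {0<..<t} s *\<^sub>R (K (t - s) * g s)"
  let ?L = "\<lambda>s. indicator {0..t} s *\<^sub>R (K (t - s) * f s)"
  note [measurable] = K g
  have H: "?H \<in> borel_measurable lborel" by measurable
  then have Hl: "?H \<in> borel_measurable lebesgue" by (rule measurable_completion)
  have "AE s in lborel. ?H s = ?L s"
    using ae AE_lborel_singleton[of 0] AE_lborel_singleton[of t]
    by eventually_elim (use t in \<open>auto simp: indicator_def\<close>)
  then have ael: "AE s in lebesgue. ?H s = ?L s" by (rule AE_completion)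
  have "volterra K f t = integral\<^sup>L lebesgue ?L" by (simp add: volterra_def set_lebesgue_integral_def)
  also have "\<dots> = integral\<^sup>L lebesgue ?H"
    by (rule integral_cong_AE[OF borel_measurable_AE[OF Hl ael] Hl]) (use ael in auto)
  also have "\<dots> = integral\<^sup>L lborel ?H" by (rule integral_completion[OF H])
  finally show ?thesis .
qed

text \<open>This is how a representation that is known only almost everywhere enters identities that are to hold at every
  \<open>t\<close>.\<close>

lemma volterra_cong_AE:
  assumes K: "K \<in> borel_measurable borel" and f: "f absolutely_integrable_on {0<..<T}"
    and ae: "AE s in lebesgue. s \<in> {0<..<T} \<longrightarrow> f' s = f s" and t: "t \<le> T"
  shows "volterra K f' t = volterra K f t"
proof -
  obtain g where g: "g \<in> borel_measurable borel" "AE s in lborel. s \<in> {0<..<T} \<longrightarrow> f s = g s"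
    using borel_representative[OF f] by blast
  have "AE s in lborel. s \<in> {0<..<T} \<longrightarrow> f' s = f s" using ae by (simp add: AE_completion_iff)
  with g(2) have "AE s in lborel. s \<in> {0<..<T} \<longrightarrow> f' s = g s" by eventually_elim auto
  then show ?thesis using volterra_representative[OF K g(1) _ t] g(2) by simp
qed

lemma volterra_cong_kernel:
  assumes K: "K \<in> borel_measurable borel" "K' \<in> borel_measurable borel"
    and f: "f absolutely_integrable_on {0<..<T}"
    and eq: "\<And>u. 0 < u \<Longrightarrow> u \<le> T \<Longrightarrow> K u = K' u" and t: "t \<le> T"
  shows "volterra K f t = volterra K' f t"
proof -
  obtain g where g: "g \<in> borel_measurable borel" "AE s in lborel. s \<in> {0<..<T} \<longrightarrow> f s = g s"
    using borel_representative[OF f] by blast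
  show ?thesis
    unfolding volterra_representative[OF K(1) g t] volterra_representative[OF K(2) g t]
    by (rule Bochner_Integration.integral_cong) (use eq t in \<open>auto simp: indicator_def\<close>)
qed

text \<open>The order \<open>a\<close> is shifted by one so that a kernel of a fractional integral of order \<open>a\<close> is bounded of order
  \<open>a\<close>, and orders add under convolution.\<close>

definition power_bounded :: "(real \<Rightarrow> complex) \<Rightarrow> real \<Rightarrow> real \<Rightarrow> bool" where
  "power_bounded K a T \<longleftrightarrow> (\<exists>C\<ge>0. \<forall>u. 0 < u \<longrightarrow> u \<le> T \<longrightarrow> norm (K u) \<le> C * u powr (a - 1))"

text \<open>Integrating first over the middle variable \<open>s\<close> gives at most
  \<open>C B(a,b) (t-r)\<^bsup>a+b-1\<^esup> \<bar>g(r)\<bar>\<close>, and the power is bounded because \<open>a + b \<ge> 1\<close>. Hence the double integral converges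
  absolutely for every \<open>t\<close>.\<close>

lemma integrable_volterra_product:
  fixes g :: "real \<Rightarrow> complex"
  assumes [measurable]: "K1 \<in> borel_measurable borel" "K2 \<in> borel_measurable borel" "g \<in> borel_measurable borel"
    and g: "integrable lborel g" and ab: "a > 0" "b > 0" "a + b \<ge> 1"
    and K1: "power_bounded K1 a t" and K2: "power_bounded K2 b t"
  shows "integrable (lborel \<Otimes>\<^sub>M lborel)
     (\<lambda>(r, s). if 0 < r \<and> r < s \<and> s < t then K1 (t - s) * (K2 (s - r) * g r) else 0)"
    (is "integrable _ (case_prod ?G)")
proof -
  obtain C1 where C1: "C1 \<ge> 0" "\<And>u. 0 < u \<Longrightarrow> u \<le> t \<Longrightarrow> norm (K1 u) \<le> C1 * u powr (a - 1)"
    using K1 unfolding power_bounded_def by blast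
  obtain C2 where C2: "C2 \<ge> 0" "\<And>u. 0 < u \<Longrightarrow> u \<le> t \<Longrightarrow> norm (K2 u) \<le> C2 * u powr (b - 1)"
    using K2 unfolding power_bounded_def by blast
  define W where "W u s = indicator {0<..<u} s * ((u - s) powr (a - 1) * s powr (b - 1))" for u s :: real
  define M where "M r s = norm (g r) * (C1 * C2) * W (t - r) (s - r)" for r s
  have Mint: "has_bochner_integral lborel (M r) (norm (g r) * (C1 * C2) * (Beta a b * (t - r) powr (a + b - 1)))"
    if "r < t" for r
  proof -
    have "has_bochner_integral lborel (W (t - r)) (Beta a b * (t - r) powr (a + b - 1))"
      unfolding W_def by (rule integral_Beta_interval) (use ab that in auto)
    then have "has_bochner_integral lborel (\<lambda>s. W (t - r) (- r + 1 * s)) (Beta a b * (t - r) powr (a + b - 1))"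
      by (subst (asm) lborel_has_bochner_integral_real_affine_iff[where c = 1 and t = "- r"]) auto
    then have "has_bochner_integral lborel (\<lambda>s. W (t - r) (s - r)) (Beta a b * (t - r) powr (a + b - 1))"
      by simp
    then show ?thesis unfolding M_def by (rule has_bochner_integral_mult_right)
  qed
  have bnd: "norm (?G r s) \<le> M r s" if r: "0 < r" "r < t" for r s
  proof (cases "r < s \<and> s < t")
    case True
    have "norm (K1 (t - s)) \<le> C1 * (t - s) powr (a - 1)" "norm (K2 (s - r)) \<le> C2 * (s - r) powr (b - 1)"
      using C1(2)[of "t - s"] C2(2)[of "s - r"] True r by auto
    then have "norm (K1 (t - s)) * norm (K2 (s - r)) \<le> (C1 * (t - s) powr (a - 1)) * (C2 * (s - r) powr (b - 1))"
      using C1(1) by (intro mult_mono) auto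
    then have "norm (g r) * (norm (K1 (t - s)) * norm (K2 (s - r))) \<le>
        norm (g r) * ((C1 * (t - s) powr (a - 1)) * (C2 * (s - r) powr (b - 1)))"
      by (intro mult_left_mono) auto
    then show ?thesis using True r by (simp add: M_def W_def norm_mult mult_ac)
  next
    case False
    then show ?thesis using C1(1) C2(1) by (auto simp: M_def W_def)
  qed
  have zero: "?G r s = 0" if "\<not> (0 < r \<and> r < t)" for r s using that by auto
  have meas: "case_prod ?G \<in> borel_measurable (lborel \<Otimes>\<^sub>M lborel)" by measurable
  have sec: "?G r \<in> borel_measurable lborel" for r by measurable
  have secint: "integrable lborel (?G r)" for r
  proof (cases "0 < r \<and> r < t")
    case True
    have "integrable lborel (M r)" using Mint[of r] True by (simp add: has_bochner_integral_iff)
    moreover have "AE s in lborel. norm (?G r s) \<le> norm (M r s)"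
    proof (rule AE_I2)
      fix s
      show "norm (?G r s) \<le> norm (M r s)"
        unfolding real_norm_def using True by (intro order_trans[OF bnd abs_ge_self]) auto
    qed
    ultimately show ?thesis by (intro Bochner_Integration.integrable_bound[OF _ sec])
  qed (simp add: zero)
  define D where "D = C1 * C2 * (Beta a b * \<bar>t\<bar> powr (a + b - 1))"
  have B0: "Beta a b \<ge> 0" using ab by (auto simp: Beta_def intro!: divide_nonneg_nonneg mult_nonneg_nonneg less_imp_le Gamma_real_pos)
  have D0: "D \<ge> 0" using C1(1) C2(1) B0 by (simp add: D_def)
  have nb: "(\<integral>s. norm (?G r s) \<partial>lborel) \<le> norm (g r) * D" for r
  proof (cases "0 < r \<and> r < t")
    case True
    then have "(\<integral>s. norm (?G r s) \<partial>lborel) \<le> integral\<^sup>L lborel (M r)"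
      using bnd[of r] Mint[of r] secint[of r]
      by (intro integral_mono) (auto simp: has_bochner_integral_iff)
    also have "\<dots> = norm (g r) * (C1 * C2) * (Beta a b * (t - r) powr (a + b - 1))"
      using Mint[of r] True by (simp add: has_bochner_integral_iff)
    also have "\<dots> \<le> norm (g r) * (C1 * C2) * (Beta a b * \<bar>t\<bar> powr (a + b - 1))"
      using True C1(1) C2(1) B0 ab by (intro mult_left_mono powr_mono2) auto
    finally show ?thesis by (simp add: D_def mult_ac)
  qed (simp add: zero D0)
  have gi: "integrable lborel (\<lambda>r. norm (g r) * D)" using g by auto
  have "integrable lborel (\<lambda>r. \<integral>s. norm (?G r s) \<partial>lborel)"
  proof (rule Bochner_Integration.integrable_bound[OF gi])
    show "(\<lambda>r. \<integral>s. norm (?G r s) \<partial>lborel) \<in> borel_measurable lborel" by measurable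
    show "AE r in lborel. norm (\<integral>s. norm (?G r s) \<partial>lborel) \<le> norm (norm (g r) * D)"
      using nb D0 by (auto simp: abs_mult)
  qed
  then show ?thesis
    by (intro lborel_pair.Fubini_integrable meas) (use secint in auto)
qed

text \<open>Interchanging the integrations turns the composition into the Volterra integral of the convolved kernel. The
  first statement is the case of the constant outer kernel 1, for which the exponents 1 and \<open>b\<close> always suffice.\<close>

theorem volterra_composition:
  assumes [measurable]: "K1 \<in> borel_measurable borel" "K2 \<in> borel_measurable borel" "K3 \<in> borel_measurable borel"
    and f: "f absolutely_integrable_on {0<..<T}" and ab: "a > 0" "b > 0" "a + b \<ge> 1"
    and K1: "power_bounded K1 a T" and K2: "power_bounded K2 b T"
    and conv: "\<And>u. 0 < u \<Longrightarrow> u \<le> T \<Longrightarrow> (\<integral>s. indicator {0<..<u} s *\<^sub>R (K1 (u - s) * K2 s) \<partial>lborel) = K3 u"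
  shows "volterra K2 f absolutely_integrable_on {0<..<T}"
    and "\<And>t. t \<le> T \<Longrightarrow> volterra K1 (volterra K2 f) t = volterra K3 f t"
proof -
  obtain g where g[measurable]: "g \<in> borel_measurable borel" and gi: "integrable lborel g"
    and gf: "AE s in lborel. s \<in> {0<..<T} \<longrightarrow> f s = g s"
    using borel_representative[OF f] by blast
  let ?k = "\<lambda>r s. if 0 < r \<and> r < s \<and> s < T then 1 * (K2 (s - r) * g r) else 0"
  define h where "h s = (\<integral>r. ?k r s \<partial>lborel)" for s
  have "power_bounded (\<lambda>_. 1) 1 T" unfolding power_bounded_def by (auto intro!: exI[of _ 1])
  then have "integrable (lborel \<Otimes>\<^sub>M lborel) (case_prod ?k)"
    using integrable_volterra_product[of "\<lambda>_. 1" K2 g 1 b T] gi ab K2 by simp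
  then have hi: "integrable lborel h"
    unfolding h_def by (rule lborel_pair.integrable_snd)
  then have hb[measurable]: "h \<in> borel_measurable borel" by simp
  have hv: "volterra K2 f s = h s" if "s \<in> {0<..<T}" for s
  proof -
    have "volterra K2 f s = (\<integral>r. indicator {0<..<s} r *\<^sub>R (K2 (s - r) * g r) \<partial>lborel)"
      by (rule volterra_representative[OF _ g gf]) (use that in auto)
    also have "\<dots> = h s" unfolding h_def
      by (rule Bochner_Integration.integral_cong) (use that in \<open>auto simp: indicator_def\<close>)
    finally show ?thesis .
  qed
  have "integrable lborel (\<lambda>s. indicator {0<..<T} s *\<^sub>R h s)" using hi by (intro integrable_mult_indicator) auto
  then have "integrable lebesgue (\<lambda>s. indicator {0<..<T} s *\<^sub>R h s)"
    by (subst integrable_completion) auto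
  also have "(\<lambda>s. indicator {0<..<T} s *\<^sub>R h s) = (\<lambda>s. indicator {0<..<T} s *\<^sub>R volterra K2 f s)"
    by (rule ext) (use hv in \<open>auto simp: indicator_def\<close>)
  finally show "volterra K2 f absolutely_integrable_on {0<..<T}" by (simp add: set_integrable_def)
  fix t assume t: "t \<le> T"
  let ?G = "\<lambda>r s. if 0 < r \<and> r < s \<and> s < t then K1 (t - s) * (K2 (s - r) * g r) else 0"
  have pb: "power_bounded K1 a t" "power_bounded K2 b t"
    using K1 K2 t unfolding power_bounded_def by (meson order_trans)+
  have Gi: "integrable (lborel \<Otimes>\<^sub>M lborel) (case_prod ?G)"
    by (rule integrable_volterra_product[of K1 K2 g a b t]) (use gi ab pb in auto)
  have "volterra K1 (volterra K2 f) t = (\<integral>s. indicator {0<..<t} s *\<^sub>R (K1 (t - s) * h s) \<partial>lborel)"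
    by (rule volterra_representative[OF _ hb _ t]) (use hv in auto)
  also have "\<dots> = (\<integral>s. \<integral>r. ?G r s \<partial>lborel \<partial>lborel)"
  proof (rule Bochner_Integration.integral_cong[OF refl])
    fix s
    show "indicator {0<..<t} s *\<^sub>R (K1 (t - s) * h s) = (\<integral>r. ?G r s \<partial>lborel)"
    proof (cases "0 < s \<and> s < t")
      case True
      then have "indicator {0<..<t} s *\<^sub>R (K1 (t - s) * h s) = (\<integral>r. K1 (t - s) * ?k r s \<partial>lborel)"
        unfolding h_def by (subst integral_mult_right_zero) simp
      also have "\<dots> = (\<integral>r. ?G r s \<partial>lborel)"
        by (rule Bochner_Integration.integral_cong) (use True t in auto)
      finally show ?thesis .
    next
      case False
      then have "(\<lambda>r. ?G r s) = (\<lambda>r. 0)" by (intro ext) auto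
      then show ?thesis using False by simp
    qed
  qed
  also have "\<dots> = (\<integral>r. \<integral>s. ?G r s \<partial>lborel \<partial>lborel)"
    by (rule lborel_pair.Fubini_integral[OF Gi])
  also have "\<dots> = (\<integral>r. indicator {0<..<t} r *\<^sub>R (K3 (t - r) * g r) \<partial>lborel)"
  proof (rule Bochner_Integration.integral_cong[OF refl])
    fix r
    show "(\<integral>s. ?G r s \<partial>lborel) = indicator {0<..<t} r *\<^sub>R (K3 (t - r) * g r)"
    proof (cases "0 < r \<and> r < t")
      case True
      have "(\<integral>s. ?G r s \<partial>lborel) = (\<integral>s. ?G r (r + 1 * s) \<partial>lborel)"
        by (subst lborel_integral_real_affine[where c = 1 and t = r]) auto
      also have "\<dots> = (\<integral>s. (indicator {0<..<t - r} s *\<^sub>R (K1 (t - r - s) * K2 s)) * g r \<partial>lborel)"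
        by (rule Bochner_Integration.integral_cong) (use True in \<open>auto simp: indicator_def algebra_simps\<close>)
      also have "\<dots> = K3 (t - r) * g r"
        using conv[of "t - r"] True t by (subst integral_mult_left_zero) simp
      finally show ?thesis using True by simp
    next
      case False
      then have "(\<lambda>s. ?G r s) = (\<lambda>s. 0)" by (intro ext) auto
      then show ?thesis using False by simp
    qed
  qed
  also have "\<dots> = volterra K3 f t"
    by (rule volterra_representative[OF _ g gf t, symmetric]) simp
  finally show "volterra K1 (volterra K2 f) t = volterra K3 f t" .
qed

section \<open>The semigroup of Prabhakar integrals\<close>

lemma prabhakar_integral_eq_volterra:
  "prabhakar_integral \<rho> \<mu> \<gamma> \<omega> = volterra (prabhakar_kernel \<rho> \<mu> \<gamma> \<omega>)"
  by (intro ext) (simp add: prabhakar_integral_def volterra_def prabhakar_kernel_def)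

lemma iterated_integral_eq_volterra:
  "iterated_integral m = volterra (\<lambda>u. of_real (u ^ (m - 1)) / fact (m - 1))"
proof (intro ext)
  fix w :: "real \<Rightarrow> complex" and t
  have "volterra (\<lambda>u. of_real (u ^ (m - 1)) / fact (m - 1)) w t =
     (LINT s:{0..t}|lebesgue. 1 / fact (m - 1) * (of_real ((t - s) ^ (m - 1)) * w s))"
    unfolding volterra_def by simp
  also have "\<dots> = iterated_integral m w t"
    unfolding iterated_integral_def by (rule set_integral_mult_right)
  finally show "iterated_integral m w t = volterra (\<lambda>u. of_real (u ^ (m - 1)) / fact (m - 1)) w t" ..
qed

lemma power_bounded_prabhakar_kernel:
  assumes "\<rho> > 0" "\<mu> > 0"
  shows "power_bounded (prabhakar_kernel \<rho> \<mu> \<gamma> \<omega>) \<mu> T"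
proof -
  have "ml_majorant \<rho> \<mu> \<gamma> (norm \<omega> * T powr \<rho>) \<ge> 0"
    unfolding ml_majorant_def by (intro suminf_nonneg summable_ml_coeff assms) auto
  then show ?thesis
    unfolding power_bounded_def using norm_prabhakar_kernel_le[OF assms] by blast
qed

theorem prabhakar_integral_semigroup:
  assumes f: "f absolutely_integrable_on {0<..<T}" and \<rho>: "\<rho> > 0"
    and ab: "a > 0" "b > 0" "a + b \<ge> 1" and t: "t \<le> T"
  shows "prabhakar_integral \<rho> a \<gamma> \<omega> (prabhakar_integral \<rho> b \<delta> \<omega> f) t = prabhakar_integral \<rho> (a + b) (\<gamma> + \<delta>) \<omega> f t"
  unfolding prabhakar_integral_eq_volterra
  by (rule volterra_composition(2)[OF _ _ _ f ab _ _ _ t])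
     (use \<rho> ab in \<open>auto intro!: power_bounded_prabhakar_kernel prabhakar_kernel_convolution\<close>)

lemma absolutely_integrable_prabhakar_integral:
  assumes f: "f absolutely_integrable_on {0<..<T}" and \<rho>: "\<rho> > 0" and b: "b > 0"
  shows "prabhakar_integral \<rho> b \<delta> \<omega> f absolutely_integrable_on {0<..<T}"
  unfolding prabhakar_integral_eq_volterra
  by (rule volterra_composition(1)[where ?a = 1 and ?b = b
        and ?K1.0 = "prabhakar_kernel \<rho> 1 0 \<omega>" and ?K3.0 = "prabhakar_kernel \<rho> (1 + b) (0 + \<delta>) \<omega>", OF _ _ _ f])
     (use \<rho> b in \<open>auto intro!: power_bounded_prabhakar_kernel prabhakar_kernel_convolution simp del: add_0\<close>)

text \<open>For \<open>\<gamma> = 0\<close> only the constant term of the series survives. At \<open>u = 0\<close> the two sides differ if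
  \<open>m = 1\<close>, since \<open>0 powr 0 = 0\<close> while \<open>0 ^ 0 = 1\<close>.\<close>

lemma prabhakar_kernel_zero:
  assumes u: "u > 0" and m: "m \<ge> 1"
  shows "prabhakar_kernel \<rho> (real m) 0 \<omega> u = of_real (u ^ (m - 1)) / fact (m - 1)"
proof -
  obtain k where k: "m = Suc k" using m by (cases m) auto
  have "mittag_leffler \<rho> (real m) 0 z = 1 / fact (m - 1)" for z
  proof -
    have "mittag_leffler \<rho> (real m) 0 z = (\<Sum>n\<in>{0}. ml_coeff \<rho> (real m) 0 n * z ^ n)"
      unfolding mittag_leffler_eq by (rule suminf_finite) (auto simp: ml_coeff_def pochhammer_0_left)
    also have "\<dots> = 1 / Gamma (of_nat m)" by (simp add: ml_coeff_def)
    also have "Gamma (of_nat m :: complex) = fact (m - 1)"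
      using Gamma_fact[of k, where ?'a = complex] by (simp add: k)
    finally show ?thesis .
  qed
  moreover have "u powr (real m - 1) = u ^ (m - 1)"
    using u by (simp add: k powr_realpow)
  ultimately show ?thesis by (simp add: prabhakar_kernel_def)
qed

lemma iterated_integral_eq_prabhakar_integral:
  assumes f: "f absolutely_integrable_on {0<..<T}" and m: "m \<ge> 1" and t: "t \<le> T"
  shows "iterated_integral m f t = prabhakar_integral \<rho> (real m) 0 \<omega> f t"
  unfolding prabhakar_integral_eq_volterra iterated_integral_eq_volterra
  by (rule volterra_cong_kernel[OF _ _ f _ t]) (auto simp: prabhakar_kernel_zero[OF _ m])

lemma absolutely_integrable_iterated_integral:
  assumes f: "f absolutely_integrable_on {0<..<T}" and m: "m \<ge> 1"
  shows "iterated_integral m f absolutely_integrable_on {0<..<T}"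
proof -
  have "prabhakar_integral 1 (real m) 0 0 f absolutely_integrable_on {0<..<T}"
    by (rule absolutely_integrable_prabhakar_integral[OF f]) (use m in auto)
  then show ?thesis
    by (rule absolutely_integrable_spike[where S = "{}"])
       (use iterated_integral_eq_prabhakar_integral[OF f m] in auto)
qed

text \<open>A special case of the semigroup law, for the kernels with \<open>\<gamma> = 0\<close>.\<close>

lemma iterated_integral_Suc:
  assumes f: "f absolutely_integrable_on {0<..<T}" and m: "m \<ge> 1" and t: "t \<le> T"
  shows "iterated_integral (Suc m) f t = iterated_integral 1 (iterated_integral m f) t"
proof -
  have "iterated_integral (Suc m) f t = prabhakar_integral 1 (real (Suc m)) 0 0 f t"
    by (rule iterated_integral_eq_prabhakar_integral[OF f _ t]) simp
  also have "\<dots> = prabhakar_integral 1 (1 + real m) (0 + 0) 0 f t" by simp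
  also have "\<dots> = prabhakar_integral 1 1 0 0 (prabhakar_integral 1 (real m) 0 0 f) t"
    by (rule prabhakar_integral_semigroup[OF f, symmetric]) (use m t in auto)
  also have "\<dots> = prabhakar_integral 1 1 0 0 (iterated_integral m f) t"
    unfolding prabhakar_integral_eq_volterra[of 1 1]
    by (rule volterra_cong_AE[OF _ absolutely_integrable_iterated_integral[OF f m] _ t])
       (use iterated_integral_eq_prabhakar_integral[OF f m] in auto)
  also have "\<dots> = iterated_integral 1 (iterated_integral m f) t"
    using iterated_integral_eq_prabhakar_integral[OF absolutely_integrable_iterated_integral[OF f m], of 1 t 1 0] t
    by simp
  finally show ?thesis .
qed

section \<open>Iterated integrals and the space of absolutely continuous functions\<close>

lemma absolutely_integrable_Icc_iff_Ioo:
  fixes f :: "real \<Rightarrow> complex"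
  shows "f absolutely_integrable_on {a..b} \<longleftrightarrow> f absolutely_integrable_on {a<..<b}"
  by (rule absolutely_integrable_spike_set_eq) (auto intro: negligible_subset[of "{a,b}"])

lemma iterated_integral_1:
  assumes f: "f absolutely_integrable_on {0<..<T}" and t: "t \<le> T"
  shows "iterated_integral 1 f t = integral {0..t} f"
proof -
  have "f absolutely_integrable_on {0..t}"
    by (rule set_integrable_subset[of _ "{0..T}"]) (use f t absolutely_integrable_Icc_iff_Ioo in auto)
  from set_lebesgue_integral_eq_integral(2)[OF this] show ?thesis
    by (simp add: iterated_integral_def)
qed

lemma continuous_on_iterated_integral:
  assumes f: "f absolutely_integrable_on {0<..<T}" and m: "m \<ge> 1"
  shows "continuous_on {0..T} (iterated_integral m f)"
proof -
  have 1: "continuous_on {0..T} (iterated_integral 1 h)" if h: "h absolutely_integrable_on {0<..<T}" for h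
  proof -
    have "h integrable_on {0..T}"
      using h set_lebesgue_integral_eq_integral(1) absolutely_integrable_Icc_iff_Ioo by blast
    then have "continuous_on {0..T} (\<lambda>x. integral {0..x} h)" by (rule indefinite_integral_continuous_1)
    then show ?thesis by (rule continuous_on_eq) (use iterated_integral_1[OF h] in auto)
  qed
  show ?thesis
  proof (cases "m = 1")
    case False
    then obtain k where k: "m = Suc k" "k \<ge> 1" using m by (cases m) auto
    from 1[OF absolutely_integrable_iterated_integral[OF f k(2)]] show ?thesis
      unfolding k(1) by (rule continuous_on_eq) (use iterated_integral_Suc[OF f k(2)] in auto)
  qed (use 1[OF f] in simp)
qed

lemma iterated_integral_has_vector_derivative:
  assumes f: "f absolutely_integrable_on {0<..<T}" and m: "m \<ge> 1" and x: "x \<in> {0..T}"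
  shows "(iterated_integral (Suc m) f has_vector_derivative iterated_integral m f x) (at x within {0..T})"
proof -
  have "((\<lambda>t. integral {0..t} (iterated_integral m f)) has_vector_derivative iterated_integral m f x) (at x within {0..T})"
    by (rule integral_has_vector_derivative[OF continuous_on_iterated_integral[OF f m] x])
  then show ?thesis
    by (rule has_vector_derivative_transform[OF x, rotated])
       (use iterated_integral_Suc[OF f m] iterated_integral_1[OF absolutely_integrable_iterated_integral[OF f m]] in auto)
qed

lemma iterated_integral_at_0:
  "iterated_integral m f 0 = 0"
proof -
  have "(LINT s:{0..0::real}|lebesgue. of_real ((0 - s) ^ (m - 1)) * f s) = 0"
    unfolding set_lebesgue_integral_def
    by (rule integral_eq_zero_AE) (auto intro!: AE_I[of _ _ "{0}"])
  then show ?thesis by (simp add: iterated_integral_def)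
qed

text \<open>Each differentiation lowers the order of the iterated integral by one. Below order \<open>m - 1\<close> the result is the
  indefinite integral of a continuous function, so the derivative exists at every point.\<close>

lemma nth_deriv_on_iterated_integral:
  assumes f: "f absolutely_integrable_on {0<..<T}" and T: "T > 0"
    and u: "\<And>x. x \<in> {0..T} \<Longrightarrow> u x = iterated_integral m f x"
    and j: "j < m" and x: "x \<in> {0..T}"
  shows "nth_deriv_on {0..T} j u x = iterated_integral (m - j) f x"
    and "Suc j < m \<Longrightarrow> (nth_deriv_on {0..T} j u has_vector_derivative iterated_integral (m - Suc j) f x) (at x within {0..T})"
proof -
  have step: "(h has_vector_derivative iterated_integral (m - Suc j) f x) (at x within {0..T})"
    if "\<forall>x\<in>{0..T}. h x = iterated_integral (m - j) f x" "Suc j < m" "x \<in> {0..T}" for h j x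
  proof -
    have "m - j = Suc (m - Suc j)" using that by simp
    with that(1) have "\<And>y. y \<in> {0..T} \<Longrightarrow> h y = iterated_integral (Suc (m - Suc j)) f y" by simp
    moreover have "(iterated_integral (Suc (m - Suc j)) f has_vector_derivative iterated_integral (m - Suc j) f x) (at x within {0..T})"
      by (rule iterated_integral_has_vector_derivative[OF f _ that(3)]) (use that in auto)
    ultimately show ?thesis by (rule has_vector_derivative_transform[OF that(3)])
  qed
  have main: "\<forall>x\<in>{0..T}. nth_deriv_on {0..T} j u x = iterated_integral (m - j) f x" if "j < m" for j
    using that
  proof (induction j)
    case 0
    then show ?case using u by simp
  next
    case (Suc j)
    then have IH: "\<forall>x\<in>{0..T}. nth_deriv_on {0..T} j u x = iterated_integral (m - j) f x" by simp
    show ?case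
    proof
      fix x assume x: "x \<in> {0..T}"
      from step[OF IH Suc.prems x] T x
      show "nth_deriv_on {0..T} (Suc j) u x = iterated_integral (m - Suc j) f x"
        by (simp add: vector_derivative_within_closed_interval)
    qed
  qed
  show "nth_deriv_on {0..T} j u x = iterated_integral (m - j) f x" using main[OF j] x by blast
  show "(nth_deriv_on {0..T} j u has_vector_derivative iterated_integral (m - Suc j) f x) (at x within {0..T})"
    if "Suc j < m"
    by (rule step[OF main[OF j] that x])
qed

text \<open>The derivative of order \<open>m - 1\<close> is the indefinite integral of \<open>f\<close>, to which Lebesgue's
  differentiation theorem applies.\<close>

lemma nth_deriv_on_top_iterated_integral:
  assumes f: "f absolutely_integrable_on {0<..<T}" and T: "T > 0" and m: "m \<ge> 1"
    and u: "\<And>x. x \<in> {0..T} \<Longrightarrow> u x = iterated_integral m f x"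
  shows "AE x in lebesgue. x \<in> {0<..<T} \<longrightarrow> nth_deriv_on {0..T} m u x = f x"
proof -
  obtain k where k: "m = Suc k" using m by (cases m) auto
  have "f integrable_on {0..T}"
    using f set_lebesgue_integral_eq_integral(1) absolutely_integrable_Icc_iff_Ioo by blast
  from Lebesgue_differentiation[OF this]
  have neg: "negligible {x \<in> {0<..<T}. \<not> ((\<lambda>u. integral {0..u} f) has_vector_derivative f x) (at x)}" .
  have "nth_deriv_on {0..T} m u x = f x"
    if x: "x \<in> {0<..<T}" and d: "((\<lambda>u. integral {0..u} f) has_vector_derivative f x) (at x)" for x
  proof -
    have xc: "x \<in> {0..T}" using x by simp
    have "nth_deriv_on {0..T} k u y = integral {0..y} f" if y: "y \<in> {0..T}" for y
    proof -
      have "nth_deriv_on {0..T} k u y = iterated_integral (m - k) f y"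
        by (rule nth_deriv_on_iterated_integral(1)[OF f T u _ y]) (simp_all add: k)
      also have "\<dots> = integral {0..y} f" using iterated_integral_1[OF f, of y] y by (simp add: k)
      finally show ?thesis .
    qed
    then have "(nth_deriv_on {0..T} k u has_vector_derivative f x) (at x within {0..T})"
      by (rule has_vector_derivative_transform[OF xc _ has_vector_derivative_at_within[OF d]])
    then show ?thesis unfolding k using T x by (simp add: vector_derivative_within_closed_interval)
  qed
  then have "{x. \<not> (x \<in> {0<..<T} \<longrightarrow> nth_deriv_on {0..T} m u x = f x)} \<subseteq>
      {x \<in> {0<..<T}. \<not> ((\<lambda>u. integral {0..u} f) has_vector_derivative f x) (at x)}"
    by blast
  with neg show ?thesis
    unfolding eventually_ae_filter_negligible by blast
qed

text \<open>Both functions are recovered almost everywhere as the derivative of order \<open>m\<close>.\<close>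

lemma iterated_integral_inj:
  assumes f: "f absolutely_integrable_on {0<..<T}" and g: "g absolutely_integrable_on {0<..<T}"
    and T: "T > 0" and m: "m \<ge> 1"
    and eq: "\<And>x. x \<in> {0..T} \<Longrightarrow> iterated_integral m f x = iterated_integral m g x"
  shows "AE x in lebesgue. x \<in> {0<..<T} \<longrightarrow> f x = g x"
proof -
  have "AE x in lebesgue. x \<in> {0<..<T} \<longrightarrow> nth_deriv_on {0..T} m (iterated_integral m f) x = f x"
    by (rule nth_deriv_on_top_iterated_integral[OF f T m]) simp
  moreover have "AE x in lebesgue. x \<in> {0<..<T} \<longrightarrow> nth_deriv_on {0..T} m (iterated_integral m f) x = g x"
    by (rule nth_deriv_on_top_iterated_integral[OF g T m eq])
  ultimately show ?thesis by eventually_elim simp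
qed

lemma iterated_integral_in_AC0:
  assumes f: "f absolutely_integrable_on {0<..<T}" and T: "T > 0" and m: "m \<ge> 1"
    and u: "\<And>x. x \<in> {0..T} \<Longrightarrow> u x = iterated_integral m f x"
  shows "u \<in> AC0 m T"
proof -
  note nth = nth_deriv_on_iterated_integral[OF f T u]
  have "nth_deriv_on {0..T} j u differentiable_on {0..T}" if "j < m - 1" for j
    unfolding differentiable_on_def
    using that by (intro ballI differentiableI_vector[OF nth(2)]) auto
  moreover have top: "nth_deriv_on {0..T} (m - 1) u x = iterated_integral 1 f x" if "x \<in> {0..T}" for x
    using nth(1)[of "m - 1" x] m that by simp
  have "continuous_on {0..T} (nth_deriv_on {0..T} (m - 1) u)"
    by (rule continuous_on_eq[OF continuous_on_iterated_integral[OF f, of 1]]) (use top in auto)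
  moreover have "abs_cont 0 T (nth_deriv_on {0..T} (m - 1) u)"
  proof (rule abs_cont_cong[OF _ abs_cont_indefinite_integral])
    show "f absolutely_integrable_on {0..T}" using f absolutely_integrable_Icc_iff_Ioo by blast
    fix x assume "x \<in> {0..T}"
    then show "integral {0..x} f = nth_deriv_on {0..T} (m - 1) u x"
      using top[of x] iterated_integral_1[OF f, of x] by simp
  qed
  moreover have "nth_deriv_on {0..T} k u 0 = 0" if "k < m" for k
    using nth(1)[of k 0] that T iterated_integral_at_0 by simp
  ultimately show ?thesis by (simp add: AC0_def AC_def C_k_on_def abs_cont_iff)
qed

text \<open>The derivative of order \<open>m - 1\<close> is the indefinite integral of some \<open>w\<close> because it is absolutely continuous
  and vanishes at 0. Descending through the lower derivatives, the fundamental theorem of calculus adds one integration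
  each time.\<close>

lemma AC0_imp_iterated_integral:
  assumes u: "u \<in> AC0 m T" and T: "T > 0" and m: "m \<ge> 1"
  obtains w where "w absolutely_integrable_on {0<..<T}" "\<And>x. x \<in> {0..T} \<Longrightarrow> u x = iterated_integral m w x"
proof -
  let ?D = "\<lambda>j. nth_deriv_on {0..T} j u"
  have diff: "\<And>j. j < m - 1 \<Longrightarrow> ?D j differentiable_on {0..T}"
    and ac: "abs_cont 0 T (?D (m - 1))" and zero: "\<And>j. j < m \<Longrightarrow> ?D j 0 = 0"
    using u by (auto simp: AC0_def AC_def C_k_on_def abs_cont_iff)
  obtain w where w: "w absolutely_integrable_on {0..T}"
    and wi: "\<And>x. x \<in> {0..T} \<Longrightarrow> ?D (m - 1) x - ?D (m - 1) 0 = integral {0..x} w"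
    using abs_cont_imp_indefinite_integral[OF T ac] by blast
  have w': "w absolutely_integrable_on {0<..<T}" using w absolutely_integrable_Icc_iff_Ioo by blast
  have "\<forall>x\<in>{0..T}. ?D (m - Suc i) x = iterated_integral (Suc i) w x" if "i < m" for i
    using that
  proof (induction i)
    case 0
    have "?D (m - 1) x = iterated_integral 1 w x" if "x \<in> {0..T}" for x
      using wi[OF that] zero[of "m - 1"] m iterated_integral_1[OF w', of x] that by simp
    then show ?case by simp
  next
    case (Suc i)
    let ?j = "m - Suc (Suc i)"
    have j: "Suc ?j = m - Suc i" "?j < m - 1" using Suc.prems by auto
    have IH: "\<And>x. x \<in> {0..T} \<Longrightarrow> ?D (m - Suc i) x = iterated_integral (Suc i) w x" using Suc by simp
    note Ji = absolutely_integrable_iterated_integral[OF w', of "Suc i"]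
    show ?case
    proof
      fix x assume x: "x \<in> {0..T}"
      have "(?D (m - Suc i) has_integral (?D ?j x - ?D ?j 0)) {0..x}"
      proof (rule fundamental_theorem_of_calculus)
        fix y assume y: "y \<in> {0..x}"
        then have "y \<in> {0..T}" using x by auto
        with diff[OF j(2)] have "?D ?j differentiable (at y within {0..T})"
          by (simp add: differentiable_on_def)
        then have "(?D ?j has_vector_derivative ?D (Suc ?j) y) (at y within {0..T})"
          by (simp add: vector_derivative_works)
        then show "(?D ?j has_vector_derivative ?D (m - Suc i) y) (at y within {0..x})"
          unfolding j(1) by (rule has_vector_derivative_within_subset) (use x in auto)
      qed (use x in auto)
      then have "?D ?j x = integral {0..x} (?D (m - Suc i))"
        using zero[of ?j] Suc.prems by (simp add: integral_unique)
      also have "\<dots> = integral {0..x} (iterated_integral (Suc i) w)"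
        by (rule Henstock_Kurzweil_Integration.integral_cong) (use IH x in auto)
      also have "\<dots> = iterated_integral (Suc (Suc i)) w x"
        using iterated_integral_1[OF Ji, of x] iterated_integral_Suc[OF w', of "Suc i" x] x by simp
      finally show "?D ?j x = iterated_integral (Suc (Suc i)) w x" .
    qed
  qed
  from this[of "m - 1"] m have "\<And>x. x \<in> {0..T} \<Longrightarrow> u x = iterated_integral m w x" by simp
  with w' that show ?thesis by blast
qed

section \<open>The range of the Prabhakar integral on continuous functions\<close>

theorem proposition8:
  fixes T \<rho> \<mu> :: real and m :: nat and \<gamma> \<omega> :: complex
    and v :: "real \<Rightarrow> complex" and R :: "(real \<Rightarrow> complex) \<Rightarrow> real \<Rightarrow> complex"
  assumes "T > 0" and "m \<ge> 1" and "real m - 1 < \<mu>" and "\<mu> < real m" and "\<rho> > 0"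
    and "R = prabhakar_integral \<rho> \<mu> \<gamma> \<omega>"
    and "continuous_on {0..T} v"
  shows "(R v \<in> AC0 m T \<longleftrightarrow>
            (\<exists>w. w absolutely_integrable_on {0<..<T} \<and>
                 (AE t in lebesgue. t \<in> {0<..<T} \<longrightarrow>
                    v t = prabhakar_integral \<rho> (real m - \<mu>) (- \<gamma>) \<omega> w t))) \<and>
         (\<forall>w. w absolutely_integrable_on {0<..<T} \<longrightarrow>
            (AE t in lebesgue. t \<in> {0<..<T} \<longrightarrow>
               v t = prabhakar_integral \<rho> (real m - \<mu>) (- \<gamma>) \<omega> w t) \<longrightarrow>
            (\<forall>t\<in>{0..T}. R v t = iterated_integral m w t) \<and>
            (AE t in lebesgue. t \<in> {0<..<T} \<longrightarrow>
               regularized_prabhakar_deriv T m \<rho> \<mu> \<gamma> \<omega> (R v) t = v t))"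
proof -
  note T = \<open>T > 0\<close> and m = \<open>m \<ge> 1\<close> and \<rho> = \<open>\<rho> > 0\<close>
  let ?S = "prabhakar_integral \<rho> (real m - \<mu>) (- \<gamma>) \<omega>"
  have \<mu>: "\<mu> > 0" "real m - \<mu> > 0" using assms(2-4) by auto
  have R: "R = prabhakar_integral \<rho> \<mu> \<gamma> \<omega>" by fact
  have Rcong: "R f t = R g t"
    if "g absolutely_integrable_on {0<..<T}" "AE s in lebesgue. s \<in> {0<..<T} \<longrightarrow> f s = g s" "t \<le> T" for f g t
    unfolding R prabhakar_integral_eq_volterra by (rule volterra_cong_AE[OF _ that]) simp
  have Scong: "?S f t = ?S g t"
    if "g absolutely_integrable_on {0<..<T}" "AE s in lebesgue. s \<in> {0<..<T} \<longrightarrow> f s = g s" "t \<le> T" for f g t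
    unfolding prabhakar_integral_eq_volterra by (rule volterra_cong_AE[OF _ that]) simp
  have Rint: "R f absolutely_integrable_on {0<..<T}" if "f absolutely_integrable_on {0<..<T}" for f
    unfolding R by (rule absolutely_integrable_prabhakar_integral[OF that \<rho> \<mu>(1)])
  have Sint: "?S f absolutely_integrable_on {0<..<T}" if "f absolutely_integrable_on {0<..<T}" for f
    by (rule absolutely_integrable_prabhakar_integral[OF that \<rho> \<mu>(2)])
  have RS: "R (?S f) t = iterated_integral m f t" if f: "f absolutely_integrable_on {0<..<T}" and t: "t \<le> T" for f t
    using prabhakar_integral_semigroup[OF f \<rho> \<mu> _ t, of \<gamma> \<omega> "- \<gamma>"]
      iterated_integral_eq_prabhakar_integral[OF f m t, of \<rho> \<omega>] m by (simp add: R)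
  have SR: "?S (R f) t = iterated_integral m f t" if f: "f absolutely_integrable_on {0<..<T}" and t: "t \<le> T" for f t
    using prabhakar_integral_semigroup[OF f \<rho> \<mu>(2,1) _ t, of "- \<gamma>" \<omega> \<gamma>]
      iterated_integral_eq_prabhakar_integral[OF f m t, of \<rho> \<omega>] m by (simp add: R)
  have v: "v absolutely_integrable_on {0<..<T}"
    using absolutely_integrable_continuous_real[OF assms(7)] absolutely_integrable_Icc_iff_Ioo by blast
  have Rv: "R v t = iterated_integral m w t"
    if w: "w absolutely_integrable_on {0<..<T}" and vw: "AE t in lebesgue. t \<in> {0<..<T} \<longrightarrow> v t = ?S w t"
      and t: "t \<le> T" for w t
    using Rcong[OF Sint[OF w] vw t] RS[OF w t] by simp
  have deriv: "AE t in lebesgue. t \<in> {0<..<T} \<longrightarrow> regularized_prabhakar_deriv T m \<rho> \<mu> \<gamma> \<omega> (R v) t = v t"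
    if w: "w absolutely_integrable_on {0<..<T}" and vw: "AE t in lebesgue. t \<in> {0<..<T} \<longrightarrow> v t = ?S w t" for w
  proof -
    have "AE x in lebesgue. x \<in> {0<..<T} \<longrightarrow> nth_deriv_on {0..T} m (R v) x = w x"
      by (rule nth_deriv_on_top_iterated_integral[OF w T m]) (use Rv[OF w vw] in auto)
    then have reg: "regularized_prabhakar_deriv T m \<rho> \<mu> \<gamma> \<omega> (R v) t = ?S w t" if "t \<le> T" for t
      unfolding regularized_prabhakar_deriv_def by (rule Scong[OF w _ that])
    show ?thesis using vw by eventually_elim (use reg in auto)
  qed
  have "\<exists>w. w absolutely_integrable_on {0<..<T} \<and> (AE t in lebesgue. t \<in> {0<..<T} \<longrightarrow> v t = ?S w t)"
    if "R v \<in> AC0 m T"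
  proof -
    obtain w where w: "w absolutely_integrable_on {0<..<T}" "\<And>t. t \<in> {0..T} \<Longrightarrow> R v t = iterated_integral m w t"
      using AC0_imp_iterated_integral[OF \<open>R v \<in> AC0 m T\<close> T m] by blast
    note u = Sint[OF w(1)]
    have "iterated_integral m v t = iterated_integral m (?S w) t" if t: "t \<in> {0..T}" for t
    proof -
      have "R v s = R (?S w) s" if "s \<in> {0<..<T}" for s
        using w(2)[of s] RS[OF w(1), of s] that by simp
      then have "?S (R v) t = ?S (R (?S w)) t"
        using t by (intro Scong[OF Rint[OF u]]) auto
      then show ?thesis using SR[OF v, of t] SR[OF u, of t] t by simp
    qed
    then have "AE t in lebesgue. t \<in> {0<..<T} \<longrightarrow> v t = ?S w t"
      by (rule iterated_integral_inj[OF v u T m])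
    with w(1) show ?thesis by blast
  qed
  moreover have "R v \<in> AC0 m T"
    if w: "w absolutely_integrable_on {0<..<T}" and vw: "AE t in lebesgue. t \<in> {0<..<T} \<longrightarrow> v t = ?S w t" for w
    by (rule iterated_integral_in_AC0[OF w T m]) (use Rv[OF w vw] in auto)
  moreover have "\<forall>t\<in>{0..T}. R v t = iterated_integral m w t"
    if w: "w absolutely_integrable_on {0<..<T}" and vw: "AE t in lebesgue. t \<in> {0<..<T} \<longrightarrow> v t = ?S w t" for w
    using Rv[OF w vw] by simp
  ultimately show ?thesis using deriv by blast
qed

end
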